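(* Let $\mathcal{S}$ be a seed pattern of geometric type with extended rank $(r,l)$, and let $(u_1,\ldots,u_r,p_1,\ldots,p_l)$ be any extended cluster in $\mathcal{S}$. For any ${\bf m}=(m_1,\ldots,m_l)\in(\mathbb{Z}_{>0})^l$ there is a unique frieze $h:\mathcal{A}_{\mathbb Z}(\mathcal{S},\emptyset)\to\mathbb{Z}$ such that $h(u_i)=1$ for all $i\in[1,r]$ and $h(p_j)=m_j$ for all $j\in[1,l]$. (Friezes obtained in this way are called unitary.)
   Context: Notation: $[m,n]$ is the set of integers $k$ with $m\le k\le n$; $[a]_+=\max(a,0)$, applied entrywise to integer matrices. For ${\bf a}=(a_1,\dots,a_n)$ and an integer column vector $L=(l_1,\dots,l_n)^T$, ${\bf a}^L=a_1^{l_1}\cdots a_n^{l_n}$. Cluster algebras of geometric type. Let $\mathbb{F}$ be a field of rational functions over $\mathbb{Q}$ in $r+l$ independent variables. A seed of extended rank $(r,l)$ in $\mathbb F$ is $\Sigma=({\bf u},{\bf p},\widetilde B)$, where ${\bf u}=(u_1,\ldots,u_r)$ (the cluster) and ${\bf p}=(p_1,\ldots,p_l)$ together freely generate $\mathbb{F}$ over $\mathbb{Q}$ (and $({\bf u},{\bf p})$ is the extended cluster), and $\widetilde B=\binom{B}{P}=(b_{i,j})$ is an $(r+l)\times r$ integer matrix whose top $r\times r$ part $B$ is skew-symmetrizable. With $B_k,P_k$ the $k$th columns of $B,P$, the mutation $\mu_k(\Sigma)=({\bf u}',{\bf p},\widetilde B')$, $k\in[1,r]$, has $u'_j=u_j$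 for $j\ne k$, $u_ku_k'={\bf u}^{[B_k]_+}{\bf p}^{[P_k]_+}+{\bf u}^{[-B_k]_+}{\bf p}^{[-P_k]_+}$, and $b'_{i,j}=-b_{i,j}$ if $i=k$ or $j=k$, $b'_{i,j}=b_{i,j}+[b_{i,k}]_+[b_{k,j}]_+-[-b_{i,k}]_+[-b_{k,j}]_+$ otherwise. Let $\mathbb{T}_r$ be the $r$-regular tree with edges at each vertex labelled by $[1,r]$. A seed pattern $\mathcal{S}=\{\Sigma_t=({\bf u}_t,{\bf p},\widetilde B_t):t\in\mathbb{T}_r\}$ assigns seeds to vertices so that $\Sigma_{t'}=\mu_k(\Sigma_t)$ whenever $t,t'$ are joined by an edge labelled $k$. Entries of the ${\bf u}_t$ are cluster variables, entries of ${\bf p}$ are frozen variables; $\widetilde{\mathfrak X}(\mathcal{S})$ is the set of all of them (extended cluster variables). $\mathcal{A}_{\mathbb Z}(\mathcal{S},\emptyset)\subset\mathbb{F}$ is the subring generated by $\widetilde{\mathfrak X}(\mathcal{S})$. A frieze of $\mathcal{A}_{\mathbb Z}(\mathcal{S},\emptyset)$ is a ring homomorphism $h:\mathcal{A}_{\mathbb Z}(\mathcal{S},\emptyset)\to\mathbb{Z}$ such that $h(u)\in\mathbb{Z}_{>0}$ for every $u\in\widetilde{\mathfrak X}(\mathcal{S})$. *)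

theory Defs
  imports Complex_Main "HOL-Library.Poly_Mapping" "HOL-Library.FuncSet"
begin

section \<open>Subrings, subfields and free generation over the rationals\<close>

definition is_subring :: "'f::field_char_0 set \<Rightarrow> bool" where
  "is_subring R \<longleftrightarrow> 1 \<in> R \<and> (\<forall>a\<in>R. \<forall>b\<in>R. a - b \<in> R \<and> a * b \<in> R)"

definition is_subfield :: "'f::field_char_0 set \<Rightarrow> bool" where
  "is_subfield K \<longleftrightarrow> is_subring K \<and> (\<forall>a\<in>K. inverse a \<in> K)"

text \<open>A polynomial over the rationals in variables indexed by natural numbers is a finitely
  supported map from exponent vectors to coefficients.\<close>

type_synonym qpoly = "(nat \<Rightarrow>\<^sub>0 nat) \<Rightarrow>\<^sub>0 rat"

definition qpoly_vars :: "qpoly \<Rightarrow> nat set" where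
  "qpoly_vars q = (\<Union>m\<in>Poly_Mapping.keys q. Poly_Mapping.keys m)"

definition qpoly_eval :: "(nat \<Rightarrow> 'f::field_char_0) \<Rightarrow> qpoly \<Rightarrow> 'f" where
  "qpoly_eval x q = (\<Sum>m\<in>Poly_Mapping.keys q. of_rat (Poly_Mapping.lookup q m) *
     (\<Prod>i\<in>Poly_Mapping.keys m. x i ^ Poly_Mapping.lookup m i))"

definition algebraically_independent :: "nat \<Rightarrow> (nat \<Rightarrow> 'f::field_char_0) \<Rightarrow> bool" where
  "algebraically_independent n x \<longleftrightarrow>
     (\<forall>q. qpoly_vars q \<subseteq> {1..n} \<and> qpoly_eval x q = 0 \<longrightarrow> q = 0)"

text \<open>A subfield of a field of characteristic 0 contains the rationals, so the subfield generated
  by a set is also the field extension of the rationals generated by it.\<close>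

definition freely_generates :: "'f::field_char_0 set \<Rightarrow> nat \<Rightarrow> (nat \<Rightarrow> 'f) \<Rightarrow> bool" where
  "freely_generates F n x \<longleftrightarrow>
     algebraically_independent n x \<and> F = is_subfield hull (x ` {1..n})"

definition rational_function_field :: "'f::field_char_0 set \<Rightarrow> nat \<Rightarrow> bool" where
  "rational_function_field F n \<longleftrightarrow> (\<exists>x. freely_generates F n x)"


section \<open>Seeds and mutations\<close>

text \<open>Only the entries \<open>cluster i\<close> with \<open>i \<in> {1..r}\<close>, \<open>frozen j\<close> with \<open>j \<in> {1..l}\<close> and
  \<open>exch i j\<close> with \<open>i \<in> {1..r + l}\<close>, \<open>j \<in> {1..r}\<close> are meaningful. Rows \<open>1..r\<close> of
  \<open>exch\<close> form \<open>B\<close>, and rows \<open>r + 1..r + l\<close> form \<open>P\<close>.\<close>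

record 'f seed =
  cluster :: "nat \<Rightarrow> 'f"
  frozen :: "nat \<Rightarrow> 'f"
  exch :: "nat \<Rightarrow> nat \<Rightarrow> int"

definition extended_cluster :: "nat \<Rightarrow> 'f seed \<Rightarrow> nat \<Rightarrow> 'f" where
  "extended_cluster r S i = (if i \<le> r then cluster S i else frozen S (i - r))"

definition skew_symmetrizable :: "nat \<Rightarrow> (nat \<Rightarrow> nat \<Rightarrow> int) \<Rightarrow> bool" where
  "skew_symmetrizable r B \<longleftrightarrow>
     (\<exists>d :: nat \<Rightarrow> int. (\<forall>i\<in>{1..r}. d i > 0) \<and>
        (\<forall>i\<in>{1..r}. \<forall>j\<in>{1..r}. d i * B i j = - (d j * B j i)))"

definition is_seed :: "'f::field_char_0 set \<Rightarrow> nat \<Rightarrow> nat \<Rightarrow> 'f seed \<Rightarrow> bool" where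
  "is_seed F r l S \<longleftrightarrow>
     freely_generates F (r + l) (extended_cluster r S) \<and> skew_symmetrizable r (exch S)"

definition seed_eq :: "nat \<Rightarrow> nat \<Rightarrow> 'f seed \<Rightarrow> 'f seed \<Rightarrow> bool" where
  "seed_eq r l S S' \<longleftrightarrow>
     (\<forall>i\<in>{1..r}. cluster S i = cluster S' i) \<and>
     (\<forall>j\<in>{1..l}. frozen S j = frozen S' j) \<and>
     (\<forall>i\<in>{1..r + l}. \<forall>j\<in>{1..r}. exch S i j = exch S' i j)"

definition pos_part :: "int \<Rightarrow> int" where
  "pos_part a = max a 0"

definition monomial :: "nat \<Rightarrow> (nat \<Rightarrow> 'f::field) \<Rightarrow> (nat \<Rightarrow> int) \<Rightarrow> 'f" where
  "monomial n a L = (\<Prod>i\<in>{1..n}. a i powi L i)"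

text \<open>The division by \<open>cluster S k\<close> solves the exchange relation, since the entries of the
  extended cluster of a seed are algebraically independent and hence nonzero.\<close>

definition mutate_cluster :: "nat \<Rightarrow> nat \<Rightarrow> nat \<Rightarrow> 'f::field seed \<Rightarrow> nat \<Rightarrow> 'f" where
  "mutate_cluster r l k S j =
     (if j = k then
        (monomial r (cluster S) (\<lambda>i. pos_part (exch S i k)) *
           monomial l (frozen S) (\<lambda>i. pos_part (exch S (r + i) k)) +
         monomial r (cluster S) (\<lambda>i. pos_part (- exch S i k)) *
           monomial l (frozen S) (\<lambda>i. pos_part (- exch S (r + i) k))) / cluster S k
      else cluster S j)"

definition mutate_exch :: "nat \<Rightarrow> (nat \<Rightarrow> nat \<Rightarrow> int) \<Rightarrow> nat \<Rightarrow> nat \<Rightarrow> int" where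
  "mutate_exch k b i j =
     (if i = k \<or> j = k then - b i j
      else b i j + pos_part (b i k) * pos_part (b k j)
             - pos_part (- b i k) * pos_part (- b k j))"

definition mutate :: "nat \<Rightarrow> nat \<Rightarrow> nat \<Rightarrow> 'f::field seed \<Rightarrow> 'f seed" where
  "mutate r l k S =
     \<lparr>cluster = mutate_cluster r l k S, frozen = frozen S, exch = mutate_exch k (exch S)\<rparr>"


section \<open>The labelled regular tree and seed patterns\<close>

definition simple_path :: "'v set \<Rightarrow> 'v set set \<Rightarrow> 'v \<Rightarrow> 'v \<Rightarrow> 'v list \<Rightarrow> bool" where
  "simple_path V E v w vs \<longleftrightarrow>
     vs \<noteq> [] \<and> hd vs = v \<and> last vs = w \<and> set vs \<subseteq> V \<and> distinct vs \<and>
     (\<forall>i. Suc i < length vs \<longrightarrow> {vs ! i, vs ! Suc i} \<in> E)"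

definition is_tree :: "'v set \<Rightarrow> 'v set set \<Rightarrow> bool" where
  "is_tree V E \<longleftrightarrow>
     V \<noteq> {} \<and>
     (\<forall>e\<in>E. \<exists>v\<in>V. \<exists>w\<in>V. v \<noteq> w \<and> e = {v, w}) \<and>
     (\<forall>v\<in>V. \<forall>w\<in>V. \<exists>!vs. simple_path V E v w vs)"

text \<open>Regularity of degree \<open>r\<close> is part of the labelling condition: the edges at each vertex
  are in bijection with \<open>{1..r}\<close>.\<close>

definition labelled_regular_tree ::
    "nat \<Rightarrow> 'v set \<Rightarrow> 'v set set \<Rightarrow> ('v set \<Rightarrow> nat) \<Rightarrow> bool" where
  "labelled_regular_tree r V E lab \<longleftrightarrow>
     is_tree V E \<and> (\<forall>v\<in>V. bij_betw lab {e\<in>E. v \<in> e} {1..r})"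

definition seed_pattern ::
    "'f::field_char_0 set \<Rightarrow> nat \<Rightarrow> nat \<Rightarrow> 'v set \<Rightarrow> 'v set set \<Rightarrow> ('v set \<Rightarrow> nat) \<Rightarrow>
       ('v \<Rightarrow> 'f seed) \<Rightarrow> bool" where
  "seed_pattern F r l V E lab \<S> \<longleftrightarrow>
     (\<forall>t\<in>V. is_seed F r l (\<S> t)) \<and>
     (\<forall>t\<in>V. \<forall>t'\<in>V. {t, t'} \<in> E \<longrightarrow>
        seed_eq r l (\<S> t') (mutate r l (lab {t, t'}) (\<S> t)))"

definition extended_cluster_variables ::
    "nat \<Rightarrow> nat \<Rightarrow> 'v set \<Rightarrow> ('v \<Rightarrow> 'f seed) \<Rightarrow> 'f set" where
  "extended_cluster_variables r l V \<S> =
     (\<Union>t\<in>V. cluster (\<S> t) ` {1..r} \<union> frozen (\<S> t) ` {1..l})"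


section \<open>Cluster algebras and friezes\<close>

definition cluster_algebra ::
    "nat \<Rightarrow> nat \<Rightarrow> 'v set \<Rightarrow> ('v \<Rightarrow> 'f::field_char_0 seed) \<Rightarrow> 'f set" where
  "cluster_algebra r l V \<S> = is_subring hull (extended_cluster_variables r l V \<S>)"

definition ring_hom_on :: "'f::field_char_0 set \<Rightarrow> ('f \<Rightarrow> int) \<Rightarrow> bool" where
  "ring_hom_on A h \<longleftrightarrow>
     h 1 = 1 \<and> (\<forall>a\<in>A. \<forall>b\<in>A. h (a + b) = h a + h b \<and> h (a * b) = h a * h b)"

text \<open>Functions on the cluster algebra are represented as extensional functions, so that
  equality of friezes is equality of functions on the cluster algebra.\<close>

definition frieze ::
    "nat \<Rightarrow> nat \<Rightarrow> 'v set \<Rightarrow> ('v \<Rightarrow> 'f::field_char_0 seed) \<Rightarrow> ('f \<Rightarrow> int) \<Rightarrow> bool" where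
  "frieze r l V \<S> h \<longleftrightarrow>
     h \<in> extensional (cluster_algebra r l V \<S>) \<and>
     ring_hom_on (cluster_algebra r l V \<S>) h \<and>
     (\<forall>x\<in>extended_cluster_variables r l V \<S>. h x > 0)"

end

theory Submission
  imports Defs "HOL-Computational_Algebra.Polynomial" "HOL-Analysis.Continuum_Not_Denumerable"
begin

text \<open>A ring homomorphism is forced by the values at one extended cluster: cluster variables
  specialize to positive rationals, and the point is that these are integers, which is the Laurent
  phenomenon with polynomial dependence on the frozen variables, evaluated at a point.

  Integrality is shown for mutations of real numbers: if all entries of the initial extended
  cluster are positive units of a countable subring \<open>R\<close> of the reals, then all mutated entries lie
  in \<open>R\<close>. For a sequence of mutations starting with \<open>j, k\<close>, where \<open>j \<noteq> k\<close>, adjoin a frozen variable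
  \<open>v\<close>, transcendental over \<open>R\<close>, that occurs only in the column \<open>k\<close> of the initial exchange matrix. Let
  \<open>z\<^sub>1, z\<^sub>2, z\<^sub>3\<close> be the entries created by the mutations \<open>j, k, j\<close>. By induction on the length, applied
  to the seed after \<open>j\<close> and to the seed after \<open>j, k, j\<close>, the final entry lies in the localizations of
  \<open>R[v, v\<inverse>]\<close> at \<open>z\<^sub>1\<close> and at \<open>z\<^sub>2 z\<^sub>3\<close>. Here \<open>z\<^sub>1 \<in> R\<close>, while \<open>z\<^sub>2\<close> and \<open>z\<^sub>3\<close> are polynomials in \<open>v\<close>
  with a unit as constant coefficient, hence regular modulo \<open>z\<^sub>1\<close>; so the entry lies in \<open>R[v, v\<inverse>]\<close>, and
  one sets \<open>v = 1\<close>. Frozen entries that are not units are replaced by transcendentals one at a time.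
  The exchange relations are subtraction-free and at most one of their two monomials involves a given
  frozen variable, so the resulting Laurent polynomial has no pole at zero and can be evaluated at the
  original entry.\<close>

section \<open>Subrings, localizations and polynomial subrings\<close>

lemma is_subringD:
  assumes "is_subring R"
  shows is_subring_one: "1 \<in> R"
    and is_subring_diff: "a \<in> R \<Longrightarrow> b \<in> R \<Longrightarrow> a - b \<in> R"
    and is_subring_mult: "a \<in> R \<Longrightarrow> b \<in> R \<Longrightarrow> a * b \<in> R"
  using assms unfolding is_subring_def by blast+

lemma is_subring_zero: "is_subring R \<Longrightarrow> 0 \<in> R"
  using is_subring_diff[of R 1 1] is_subring_one[of R] by simp

lemma is_subring_add:
  assumes "is_subring R" "a \<in> R" "b \<in> R"
  shows "a + b \<in> R"
proof -
  have "a - (0 - b) \<in> R"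
    using assms by (intro is_subring_diff is_subring_zero)
  then show ?thesis by simp
qed

lemma is_subring_power: "is_subring R \<Longrightarrow> a \<in> R \<Longrightarrow> a ^ n \<in> R"
  by (induction n) (simp_all add: is_subring_one is_subring_mult)

lemma is_subring_sum: "is_subring R \<Longrightarrow> (\<And>i. i \<in> I \<Longrightarrow> f i \<in> R) \<Longrightarrow> sum f I \<in> R"
  by (induction I rule: infinite_finite_induct) (simp_all add: is_subring_zero is_subring_add)

lemma is_subring_prod: "is_subring R \<Longrightarrow> (\<And>i. i \<in> I \<Longrightarrow> f i \<in> R) \<Longrightarrow> prod f I \<in> R"
  by (induction I rule: infinite_finite_induct) (simp_all add: is_subring_one is_subring_mult)

lemma is_subring_hull: "is_subring (is_subring hull X)"
  unfolding is_subring_def hull_def by blast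

text \<open>Since \<open>inverse 0 = 0\<close>, zero passes as a unit of any subring; this is why
  nonvanishing is stated separately wherever units occur.\<close>

definition unit_in :: "'f::field_char_0 set \<Rightarrow> 'f \<Rightarrow> bool" where
  "unit_in R a \<longleftrightarrow> a \<in> R \<and> inverse a \<in> R"

lemma unit_in_mult: "is_subring R \<Longrightarrow> unit_in R a \<Longrightarrow> unit_in R b \<Longrightarrow> unit_in R (a * b)"
  by (simp add: unit_in_def is_subring_mult)

lemma unit_in_inverse: "unit_in R a \<Longrightarrow> unit_in R (inverse a)"
  by (simp add: unit_in_def)

lemma unit_in_divide: "is_subring R \<Longrightarrow> unit_in R a \<Longrightarrow> unit_in R b \<Longrightarrow> unit_in R (a / b)"
  by (simp add: divide_inverse unit_in_mult unit_in_inverse)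

lemma unit_in_one: "is_subring R \<Longrightarrow> unit_in R 1"
  by (simp add: unit_in_def is_subring_one)

lemma unit_in_power: "is_subring R \<Longrightarrow> unit_in R a \<Longrightarrow> unit_in R (a ^ n)"
  by (induction n) (simp_all add: unit_in_one unit_in_mult)

lemma unit_in_prod: "is_subring R \<Longrightarrow> (\<And>i. i \<in> I \<Longrightarrow> unit_in R (f i)) \<Longrightarrow> unit_in R (prod f I)"
  by (induction I rule: infinite_finite_induct) (simp_all add: unit_in_one unit_in_mult)

lemma unit_in_mono: "unit_in R a \<Longrightarrow> R \<subseteq> R' \<Longrightarrow> unit_in R' a"
  by (auto simp: unit_in_def)

text \<open>The ring R[1/a] realised inside the ambient field, for nonzero \<open>a\<close>. For
  \<open>a = 0\<close> and \<open>0\<close> in \<open>R\<close> the set is the whole field.\<close>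

definition localization :: "'f::field_char_0 set \<Rightarrow> 'f \<Rightarrow> 'f set" where
  "localization R a = {y. \<exists>n. a ^ n * y \<in> R}"

lemma subset_localization: "R \<subseteq> localization R a"
  unfolding localization_def by (auto intro: exI[of _ 0])

lemma is_subring_localization:
  assumes R: "is_subring R" and a: "a \<in> R"
  shows "is_subring (localization R a)"
  unfolding is_subring_def
proof (intro conjI ballI)
  show "1 \<in> localization R a"
    using subset_localization is_subring_one[OF R] by blast
next
  fix y z assume "y \<in> localization R a" "z \<in> localization R a"
  then obtain m n where mn: "a ^ m * y \<in> R" "a ^ n * z \<in> R"
    unfolding localization_def by blast
  have "a ^ (m + n) * (y - z) = a ^ n * (a ^ m * y) - a ^ m * (a ^ n * z)"
    by (simp add: power_add algebra_simps)
  also have "\<dots> \<in> R"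
    using is_subring_diff[OF R is_subring_mult[OF R is_subring_power[OF R a] mn(1)]
        is_subring_mult[OF R is_subring_power[OF R a] mn(2)]] .
  finally show "y - z \<in> localization R a"
    unfolding localization_def by blast
  have "a ^ (m + n) * (y * z) = (a ^ m * y) * (a ^ n * z)"
    by (simp add: power_add algebra_simps)
  also have "\<dots> \<in> R"
    using is_subring_mult[OF R mn] .
  finally show "y * z \<in> localization R a"
    unfolding localization_def by blast
qed

lemma countable_localization:
  assumes "countable R" "a \<noteq> 0"
  shows "countable (localization R a)"
proof -
  have "localization R a \<subseteq> (\<lambda>(c, n). c / a ^ n) ` (R \<times> UNIV)"
  proof
    fix y assume "y \<in> localization R a"
    then obtain n where "a ^ n * y \<in> R"
      unfolding localization_def by blast
    moreover have "y = (a ^ n * y) / a ^ n"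
      using assms by simp
    ultimately show "y \<in> (\<lambda>(c, n). c / a ^ n) ` (R \<times> UNIV)"
      by (metis (mono_tags, lifting) UNIV_I case_prod_conv mem_Sigma_iff rev_image_eqI)
  qed
  then show ?thesis
    using assms by (meson countableI_type countable_SIGMA countable_image countable_subset)
qed

lemma unit_in_localization:
  assumes "is_subring R" "a \<in> R" "a \<noteq> 0"
  shows "unit_in (localization R a) a"
proof -
  have "a ^ 1 * inverse a \<in> R"
    using assms by (simp add: is_subring_one)
  then show ?thesis
    using assms subset_localization[of R a] unfolding unit_in_def localization_def by blast
qed

text \<open>The inverse of \<open>a\<close> is \<open>b\<close> divided by the denominator
  \<open>a * b\<close>.\<close>

lemma unit_in_localization_factor:
  assumes R: "is_subring R" and ab: "a \<in> R" "b \<in> R" "a * b \<noteq> 0"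
  shows "unit_in (localization R (a * b)) a"
proof -
  have "(a * b) ^ 1 * inverse a = b"
    using ab by (simp add: field_simps)
  then have "(a * b) ^ 1 * inverse a \<in> R"
    using ab(2) by metis
  then show ?thesis
    using ab subset_localization[of R "a * b"] unfolding unit_in_def localization_def by blast
qed

text \<open>In ring terms, \<open>b\<close> is not a zero divisor in R/aR; the elementwise form
  avoids quotient rings.\<close>

definition regular_mod :: "'f::field_char_0 set \<Rightarrow> 'f \<Rightarrow> 'f \<Rightarrow> bool" where
  "regular_mod R a b \<longleftrightarrow> b \<in> R \<and> (\<forall>c\<in>R. \<forall>e\<in>R. b * c = a * e \<longrightarrow> (\<exists>f\<in>R. c = a * f))"

lemma regular_mod_mult:
  assumes R: "is_subring R" and b: "regular_mod R a b" and b': "regular_mod R a b'"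
  shows "regular_mod R a (b * b')"
  unfolding regular_mod_def
proof (intro conjI ballI impI)
  show "b * b' \<in> R"
    using assms by (simp add: regular_mod_def is_subring_mult)
  fix c e assume ce: "c \<in> R" "e \<in> R" "b * b' * c = a * e"
  have "b' * c \<in> R"
    using b' ce R by (simp add: regular_mod_def is_subring_mult)
  then obtain f where "f \<in> R" "b' * c = a * f"
    using b ce unfolding regular_mod_def by (metis mult.assoc)
  then show "\<exists>f\<in>R. c = a * f"
    using b' ce unfolding regular_mod_def by blast
qed

lemma regular_mod_power:
  assumes R: "is_subring R" and b: "regular_mod R a b"
  shows "regular_mod R a (b ^ n)"
proof (induction n)
  case 0
  show ?case
    using is_subring_one[OF R] by (auto simp: regular_mod_def)
next
  case (Suc n)
  then show ?case
    using regular_mod_mult[OF R b] by simp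
qed

text \<open>Descent on the power of \<open>a\<close> in the denominator: \<open>b ^ m\<close> times
  \<open>a ^ Suc n * y\<close> is \<open>a\<close> times an element of \<open>R\<close>, so
  regularity of \<open>b ^ m\<close> modulo \<open>a\<close> cancels one factor \<open>a\<close>.
  This glues the two localizations in the Laurent argument.\<close>

lemma localization_Int_subset:
  assumes R: "is_subring R" and a: "a \<in> R" "a \<noteq> 0" and b: "regular_mod R a b"
  shows "localization R a \<inter> localization R b \<subseteq> R"
proof
  fix y assume "y \<in> localization R a \<inter> localization R b"
  then obtain n m where n: "a ^ n * y \<in> R" and m: "b ^ m * y \<in> R"
    unfolding localization_def by blast
  from n show "y \<in> R"
  proof (induction n)
    case (Suc n)
    have "b ^ m * (a ^ Suc n * y) = a * (a ^ n * (b ^ m * y))"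
      by (simp add: algebra_simps)
    moreover have "a ^ n * (b ^ m * y) \<in> R"
      by (rule is_subring_mult[OF R is_subring_power[OF R a(1)] m])
    ultimately obtain f where "f \<in> R" "a ^ Suc n * y = a * f"
      using regular_mod_power[OF R b, of m] Suc.prems unfolding regular_mod_def by blast
    then have "a ^ n * y \<in> R"
      using a by (simp add: mult.assoc)
    then show ?case
      by (rule Suc.IH)
  qed simp
qed

section \<open>Polynomials with coefficients in a subring\<close>

definition polys_over :: "'f::field_char_0 set \<Rightarrow> 'f poly set" where
  "polys_over R = {p. \<forall>n. coeff p n \<in> R}"

lemma polys_over_pCons:
  "pCons c p \<in> polys_over R \<longleftrightarrow> c \<in> R \<and> p \<in> polys_over R"
proof
  assume *: "pCons c p \<in> polys_over R"
  have "coeff (pCons c p) 0 \<in> R" "coeff (pCons c p) (Suc n) \<in> R" for n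
    using * unfolding polys_over_def by blast+
  then show "c \<in> R \<and> p \<in> polys_over R"
    by (simp add: polys_over_def)
qed (auto simp: polys_over_def coeff_pCons split: nat.split)

lemma polys_over_zero: "is_subring R \<Longrightarrow> 0 \<in> polys_over R"
  by (simp add: polys_over_def is_subring_zero)

lemma polys_over_diff: "is_subring R \<Longrightarrow> p \<in> polys_over R \<Longrightarrow> q \<in> polys_over R \<Longrightarrow> p - q \<in> polys_over R"
  by (simp add: polys_over_def is_subring_diff)

lemma polys_over_add: "is_subring R \<Longrightarrow> p \<in> polys_over R \<Longrightarrow> q \<in> polys_over R \<Longrightarrow> p + q \<in> polys_over R"
  by (simp add: polys_over_def is_subring_add)

lemma polys_over_mult: "is_subring R \<Longrightarrow> p \<in> polys_over R \<Longrightarrow> q \<in> polys_over R \<Longrightarrow> p * q \<in> polys_over R"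
  by (simp add: polys_over_def coeff_mult is_subring_sum is_subring_mult)

lemma polys_over_const: "is_subring R \<Longrightarrow> c \<in> R \<Longrightarrow> [:c:] \<in> polys_over R"
  by (simp add: polys_over_pCons polys_over_zero)

lemma polys_over_power: "is_subring R \<Longrightarrow> p \<in> polys_over R \<Longrightarrow> p ^ n \<in> polys_over R"
  by (induction n) (simp_all add: polys_over_mult polys_over_const is_subring_one one_pCons)

lemma polys_over_sum:
  "is_subring R \<Longrightarrow> (\<And>i. i \<in> I \<Longrightarrow> f i \<in> polys_over R) \<Longrightarrow> sum f I \<in> polys_over R"
  by (induction I rule: infinite_finite_induct) (simp_all add: polys_over_zero polys_over_add)

lemma poly_polys_over:
  assumes "is_subring R" "p \<in> polys_over R" "x \<in> R"
  shows "poly p x \<in> R"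
  using assms(2)
  by (induction p)
     (use assms in \<open>auto simp: polys_over_pCons is_subring_zero is_subring_add is_subring_mult\<close>)

lemma countable_polys_over:
  assumes "countable R"
  shows "countable (polys_over R)"
proof -
  have "polys_over R \<subseteq> Poly ` lists R"
  proof
    fix p assume p: "p \<in> polys_over R"
    have "coeffs p \<in> lists R"
      using p by (auto simp: coeffs_def polys_over_def)
    then show "p \<in> Poly ` lists R"
      by (metis Poly_coeffs image_eqI)
  qed
  then show ?thesis
    using assms by (meson countable_image countable_lists countable_subset)
qed

section \<open>Transcendental elements and Laurent polynomial rings\<close>

definition transcendental_over :: "'f::field_char_0 set \<Rightarrow> 'f \<Rightarrow> bool" where
  "transcendental_over R v \<longleftrightarrow> (\<forall>p\<in>polys_over R. poly p v = 0 \<longrightarrow> p = 0)"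

lemma transcendental_over_eqD:
  assumes "is_subring R" "transcendental_over R v" "p \<in> polys_over R" "q \<in> polys_over R"
    and "poly p v = poly q v"
  shows "p = q"
  using assms polys_over_diff[of R p q] unfolding transcendental_over_def
  by (metis cancel_comm_monoid_add_class.diff_cancel eq_iff_diff_eq_0 poly_diff)

text \<open>Countability is carried along all subrings for this purpose: countably many polynomials
  have countably many roots, and these cannot fill an interval.\<close>

lemma exists_transcendental_over:
  fixes R :: "real set"
  assumes "countable R"
  obtains v where "v > 0" "transcendental_over R v"
proof -
  define Z where "Z = (\<Union>p\<in>polys_over R - {0}. {x. poly p x = 0})"
  have "countable Z"
    unfolding Z_def using countable_polys_over[OF assms]
    by (auto intro!: countable_UN intro: countable_finite poly_roots_finite)
  then have "\<not> {0<..<1} \<subseteq> Z"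
    using uncountable_open_interval[of 0 1] countable_subset by auto
  then obtain v where "v > 0" "v \<notin> Z"
    by (meson greaterThanLessThan_iff subsetI)
  then show thesis
    by (intro that) (auto simp: Z_def transcendental_over_def)
qed

text \<open>The ring R[v, 1/v] inside the field; when \<open>v\<close> is transcendental over
  \<open>R\<close> it is a genuine Laurent polynomial ring.\<close>

definition laurent_over :: "'f::field_char_0 set \<Rightarrow> 'f \<Rightarrow> 'f set" where
  "laurent_over R v = localization ((\<lambda>p. poly p v) ` polys_over R) v"

lemma is_subring_poly_image:
  assumes R: "is_subring R"
  shows "is_subring ((\<lambda>p. poly p v) ` polys_over R)"
  unfolding is_subring_def
proof (intro conjI ballI)
  show "1 \<in> (\<lambda>p. poly p v) ` polys_over R"
    using polys_over_const[OF R is_subring_one[OF R]] by (intro image_eqI[of _ _ "[:1:]"]) auto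
next
  fix a b assume "a \<in> (\<lambda>p. poly p v) ` polys_over R" "b \<in> (\<lambda>p. poly p v) ` polys_over R"
  then obtain p q where "p \<in> polys_over R" "q \<in> polys_over R" "a = poly p v" "b = poly q v"
    by blast
  then show "a - b \<in> (\<lambda>p. poly p v) ` polys_over R" "a * b \<in> (\<lambda>p. poly p v) ` polys_over R"
    using polys_over_diff[OF R, of p q] polys_over_mult[OF R, of p q]
    by (auto intro: image_eqI[of _ _ "p - q"] image_eqI[of _ _ "p * q"])
qed

lemma variable_in_poly_image:
  assumes R: "is_subring R"
  shows "v \<in> (\<lambda>p. poly p v) ` polys_over R"
proof -
  have "[:0, 1:] \<in> polys_over R"
    using R by (simp add: polys_over_pCons polys_over_zero is_subring_zero is_subring_one)
  then show ?thesis
    by (intro image_eqI[of _ _ "[:0, 1:]"]) auto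
qed

lemma laurent_overI:
  assumes "p \<in> polys_over R" "v ^ n * y = poly p v"
  shows "y \<in> laurent_over R v"
  using assms unfolding laurent_over_def localization_def by auto

lemma laurent_overE:
  assumes "y \<in> laurent_over R v"
  obtains p n where "p \<in> polys_over R" "v ^ n * y = poly p v"
  using assms unfolding laurent_over_def localization_def by auto

lemma poly_in_laurent_over: "p \<in> polys_over R \<Longrightarrow> poly p v \<in> laurent_over R v"
  by (rule laurent_overI[of p R v 0]) auto

lemma is_subring_laurent_over: "is_subring R \<Longrightarrow> is_subring (laurent_over R v)"
  unfolding laurent_over_def
  by (intro is_subring_localization is_subring_poly_image variable_in_poly_image)

lemma countable_laurent_over: "countable R \<Longrightarrow> v \<noteq> 0 \<Longrightarrow> countable (laurent_over R v)"
  unfolding laurent_over_def by (intro countable_localization countable_image countable_polys_over)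

lemma subset_laurent_over:
  assumes "is_subring R"
  shows "R \<subseteq> laurent_over R v"
proof
  fix c assume "c \<in> R"
  then show "c \<in> laurent_over R v"
    using poly_in_laurent_over[OF polys_over_const[OF assms], of c v] by simp
qed

lemma unit_in_laurent_over:
  assumes R: "is_subring R" and "v \<noteq> 0"
  shows "unit_in (laurent_over R v) v"
  unfolding laurent_over_def
  using assms by (intro unit_in_localization is_subring_poly_image variable_in_poly_image)

text \<open>Modulo \<open>a\<close>, a polynomial whose constant coefficient is a unit is not a zero divisor: the
  lowest coefficient of a cofactor would have to vanish.\<close>

lemma regular_mod_laurent_over:
  assumes R: "is_subring R" and v: "transcendental_over R v" "v \<noteq> 0"
    and g: "g \<in> polys_over R" "unit_in R (coeff g 0)" and nz: "coeff g 0 \<noteq> 0"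
    and a: "a \<in> R" "a \<noteq> 0"
  shows "regular_mod (laurent_over R v) a (poly g v)"
  unfolding regular_mod_def
proof (intro conjI ballI impI)
  show "poly g v \<in> laurent_over R v"
    using g(1) by (rule poly_in_laurent_over)
  fix c e assume "c \<in> laurent_over R v" "e \<in> laurent_over R v" and eq: "poly g v * c = a * e"
  then obtain p q m n where p: "p \<in> polys_over R" "v ^ m * c = poly p v"
    and q: "q \<in> polys_over R" "v ^ n * e = poly q v"
    by (metis laurent_overE)
  define X where "X = [:0, 1 :: 'a:]"
  have X: "X \<in> polys_over R"
    using R by (simp add: X_def polys_over_pCons polys_over_zero is_subring_zero is_subring_one)
  \<comment> \<open>Multiplying by \<open>v ^ (n + m)\<close> clears both denominators, and
    transcendence of \<open>v\<close> then upgrades the equality of values to the polynomial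
    identity \<open>g * p' = q'\<close>.\<close>
  define p' where "p' = X ^ n * p"
  define q' where "q' = [:a:] * (X ^ m * q)"
  have p': "p' \<in> polys_over R" and q': "q' \<in> polys_over R" "X ^ m * q \<in> polys_over R"
    unfolding p'_def q'_def using R X p q a
    by (blast intro: polys_over_mult polys_over_power polys_over_const)+
  have "poly (g * p') v = v ^ (n + m) * (poly g v * c)"
    by (simp add: p'_def X_def p(2)[symmetric] power_add algebra_simps)
  also have "\<dots> = v ^ (n + m) * (a * e)"
    by (simp only: eq)
  also have "\<dots> = poly q' v"
    by (simp add: q'_def X_def q(2)[symmetric] power_add)
  finally have gp: "g * p' = q'"
    using R v g p' q' by (intro transcendental_over_eqD) (auto intro: polys_over_mult)
  \<comment> \<open>Comparing coefficients at \<open>i\<close> expresses \<open>coeff p' i\<close>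
    through lower coefficients of \<open>p'\<close>, a multiple of \<open>a\<close>, and the inverse
    of the unit \<open>coeff g 0\<close>.\<close>
  have div: "coeff p' i / a \<in> R" for i
  proof (induction i rule: less_induct)
    case (less i)
    have "coeff q' i = (\<Sum>k\<le>i. coeff g k * coeff p' (i - k))"
      by (simp add: gp[symmetric] coeff_mult)
    also have "{..i} = insert 0 {1..i}"
      by auto
    also have "(\<Sum>k\<in>insert 0 {1..i}. coeff g k * coeff p' (i - k)) =
        coeff g 0 * coeff p' i + (\<Sum>k\<in>{1..i}. coeff g k * coeff p' (i - k))"
      by simp
    finally have "coeff p' i / a = inverse (coeff g 0) *
        (coeff (X ^ m * q) i - (\<Sum>k\<in>{1..i}. coeff g k * (coeff p' (i - k) / a)))"
      using nz a by (simp add: q'_def field_simps sum_divide_distrib[symmetric])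
    also have "\<dots> \<in> R"
      using R g q'(2) less.IH
      by (intro is_subring_mult is_subring_diff is_subring_sum)
         (auto simp: unit_in_def polys_over_def)
    finally show ?case .
  qed
  have "[:1 / a:] * p' \<in> polys_over R"
    using div by (simp add: polys_over_def)
  moreover have "v ^ (n + m) * (c / a) = poly ([:1 / a:] * p') v"
    by (simp add: p'_def X_def p(2)[symmetric] power_add)
  ultimately have "c / a \<in> laurent_over R v"
    by (rule laurent_overI)
  then show "\<exists>f\<in>laurent_over R v. c = a * f"
    using a by (intro bexI[of _ "c / a"]) auto
qed


section \<open>Mutation of numerical seeds\<close>

text \<open>\<open>nat\<close> sends negative exponents to 0, so the exponents are the positive
  parts of the column and of its negative. One index set \<open>N\<close> serves cluster and frozen
  entries alike.\<close>

definition exchange_sum :: "nat set \<Rightarrow> nat \<Rightarrow> (nat \<Rightarrow> nat \<Rightarrow> int) \<Rightarrow> (nat \<Rightarrow> 'a::field) \<Rightarrow> 'a" where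
  "exchange_sum N k b x = (\<Prod>i\<in>N. x i ^ nat (b i k)) + (\<Prod>i\<in>N. x i ^ nat (- b i k))"

text \<open>Values may lie in any field, so the same recursion runs on cluster variables and on
  their real specializations.\<close>

definition seed_step ::
    "nat set \<Rightarrow> nat \<Rightarrow> (nat \<Rightarrow> nat \<Rightarrow> int) \<times> (nat \<Rightarrow> 'a::field) \<Rightarrow> (nat \<Rightarrow> nat \<Rightarrow> int) \<times> (nat \<Rightarrow> 'a)" where
  "seed_step N k s =
     (mutate_exch k (fst s), (snd s)(k := exchange_sum N k (fst s) (snd s) / snd s k))"

definition seed_run ::
    "nat set \<Rightarrow> nat list \<Rightarrow> (nat \<Rightarrow> nat \<Rightarrow> int) \<times> (nat \<Rightarrow> 'a::field) \<Rightarrow> (nat \<Rightarrow> nat \<Rightarrow> int) \<times> (nat \<Rightarrow> 'a)" where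
  "seed_run N ks s = fold (seed_step N) ks s"

lemma seed_run_simps [simp]:
  "seed_run N [] s = s"
  "seed_run N (k # ks) s = seed_run N ks (seed_step N k s)"
  "seed_run N (ks @ [k]) s = seed_step N k (seed_run N ks s)"
  by (simp_all add: seed_run_def)

lemma fst_seed_step [simp]: "fst (seed_step N k s) = mutate_exch k (fst s)"
  by (simp add: seed_step_def)

lemma fst_seed_run: "fst (seed_run N ks s) = fold mutate_exch ks (fst s)"
  by (induction ks arbitrary: s) simp_all

lemma snd_seed_step_other: "i \<noteq> k \<Longrightarrow> snd (seed_step N k s) i = snd s i"
  by (simp add: seed_step_def)

lemma snd_seed_run_frozen: "i \<notin> set ks \<Longrightarrow> snd (seed_run N ks s) i = snd s i"
  by (induction ks arbitrary: s) (simp_all add: snd_seed_step_other)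

section \<open>Skew-symmetrizability under mutation\<close>

lemma skew_symmetrizable_diag:
  assumes "skew_symmetrizable r b" "k \<in> {1..r}"
  shows "b k k = 0"
proof -
  obtain d :: "nat \<Rightarrow> int" where "d k > 0" "d k * b k k = - (d k * b k k)"
    using assms unfolding skew_symmetrizable_def by blast
  then have "d k * b k k = 0"
    by linarith
  with \<open>d k > 0\<close> show ?thesis
    by simp
qed

lemma skew_symmetrizable_sgn:
  assumes "skew_symmetrizable r b" "j \<in> {1..r}" "k \<in> {1..r}"
  shows "b j k < 0 \<longleftrightarrow> b k j > 0"
proof -
  obtain d :: "nat \<Rightarrow> int" where d: "d j > 0" "d k > 0" "d j * b j k = - (d k * b k j)"
    using assms unfolding skew_symmetrizable_def by blast
  have "b j k < 0 \<longleftrightarrow> d j * b j k < 0"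
    using d(1) by (simp add: mult_less_0_iff)
  also have "\<dots> \<longleftrightarrow> d k * b k j > 0"
    using d(3) by linarith
  also have "\<dots> \<longleftrightarrow> b k j > 0"
    using d(2) by (simp add: zero_less_mult_iff)
  finally show ?thesis .
qed

lemma skew_symmetrizable_cong:
  assumes "skew_symmetrizable r b" and eq: "\<And>i j. i \<in> {1..r} \<Longrightarrow> j \<in> {1..r} \<Longrightarrow> b' i j = b i j"
  shows "skew_symmetrizable r b'"
proof -
  obtain d :: "nat \<Rightarrow> int" where "\<forall>i\<in>{1..r}. d i > 0"
    "\<forall>i\<in>{1..r}. \<forall>j\<in>{1..r}. d i * b i j = - (d j * b j i)"
    using assms unfolding skew_symmetrizable_def by blast
  then have "(\<forall>i\<in>{1..r}. d i > 0) \<and> (\<forall>i\<in>{1..r}. \<forall>j\<in>{1..r}. d i * b' i j = - (d j * b' j i))"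
    by (metis eq)
  then show ?thesis
    unfolding skew_symmetrizable_def by blast
qed

lemma pos_part_mult: "d > 0 \<Longrightarrow> d * pos_part a = pos_part (d * a)"
  by (simp add: pos_part_def max_mult_distrib_left)

text \<open>The same symmetrizer \<open>d\<close> works: by \<open>swap\<close>, it carries the
  positive correction term at (i, j) to the negative one at (j, i).\<close>

lemma skew_symmetrizable_mutate_exch:
  assumes skew: "skew_symmetrizable r b" and k: "k \<in> {1..r}"
  shows "skew_symmetrizable r (mutate_exch k b)"
proof -
  obtain d :: "nat \<Rightarrow> int" where d: "\<And>i. i \<in> {1..r} \<Longrightarrow> d i > 0"
    and b: "\<And>i j. i \<in> {1..r} \<Longrightarrow> j \<in> {1..r} \<Longrightarrow> d i * b i j = - (d j * b j i)"
    using skew unfolding skew_symmetrizable_def by blast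
  have swap: "d i * (pos_part (b i k) * pos_part (b k j)) =
      d j * (pos_part (- b j k) * pos_part (- b k i))" if "i \<in> {1..r}" "j \<in> {1..r}" for i j
  proof -
    have "d i * pos_part (b i k) = d k * pos_part (- b k i)"
      and "d k * pos_part (b k j) = d j * pos_part (- b j k)"
      using b[OF that(1) k] b[OF k that(2)] 
      unfolding pos_part_mult[OF d[OF that(1)]] pos_part_mult[OF d[OF that(2)]] pos_part_mult[OF d[OF k]]
      by simp_all
    then show ?thesis
      by (metis mult.assoc mult.commute)
  qed
  have "d i * mutate_exch k b i j = - (d j * mutate_exch k b j i)"
    if ij: "i \<in> {1..r}" "j \<in> {1..r}" for i j
    unfolding mutate_exch_def using b[OF ij] swap[OF ij] swap[OF ij(2,1)]
    by (simp add: distrib_left right_diff_distrib mult.commute[of "pos_part (- b j k)"]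
        mult.commute[of "pos_part (- b i k)"])
  then show ?thesis
    using d unfolding skew_symmetrizable_def by blast
qed

section \<open>Involutivity and positivity of mutation\<close>

lemma mutate_exch_involution: "mutate_exch k (mutate_exch k b) = b"
  by (intro ext) (simp add: mutate_exch_def)

text \<open>Negating column \<open>k\<close> swaps the two monomials, and the changed value at
  \<open>k\<close> enters with exponent 0.\<close>

lemma exchange_sum_step:
  assumes "b k k = 0"
  shows "exchange_sum N k (mutate_exch k b) (x(k := y)) = exchange_sum N k b x"
proof -
  have "(\<Prod>i\<in>N. (x(k := y)) i ^ nat (mutate_exch k b i k)) = (\<Prod>i\<in>N. x i ^ nat (- b i k))"
    and "(\<Prod>i\<in>N. (x(k := y)) i ^ nat (- mutate_exch k b i k)) = (\<Prod>i\<in>N. x i ^ nat (b i k))"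
    using assms by (auto intro!: prod.cong simp: mutate_exch_def)
  then show ?thesis
    unfolding exchange_sum_def by simp
qed

lemma seed_step_involution:
  assumes "b k k = 0" "x k \<noteq> 0" "exchange_sum N k b x \<noteq> 0"
  shows "seed_step N k (seed_step N k (b, x)) = (b, x)"
  using assms by (simp add: seed_step_def mutate_exch_involution exchange_sum_step)

lemma exchange_sum_pos:
  fixes x :: "nat \<Rightarrow> real"
  assumes "\<And>i. i \<in> N \<Longrightarrow> x i > 0"
  shows "exchange_sum N k b x > 0"
  unfolding exchange_sum_def using assms by (intro add_pos_pos prod_pos zero_less_power)

lemma seed_step_pos:
  fixes s :: "_ \<times> (nat \<Rightarrow> real)"
  assumes "\<And>i. i \<in> N \<Longrightarrow> snd s i > 0" "k \<in> N" "i \<in> N"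
  shows "snd (seed_step N k s) i > 0"
  using assms by (auto simp: seed_step_def exchange_sum_pos)

lemma seed_run_pos:
  fixes s :: "_ \<times> (nat \<Rightarrow> real)"
  assumes "\<And>i. i \<in> N \<Longrightarrow> snd s i > 0" "set ks \<subseteq> N" "i \<in> N"
  shows "snd (seed_run N ks s) i > 0"
  using assms by (induction ks arbitrary: s) (simp_all add: seed_step_pos)

text \<open>The rows in \<open>N' - N\<close> carry the value 1 and are therefore invisible in
  exchange relations. With \<open>N' = N\<close> the relation says that two seeds agree on all
  meaningful entries.\<close>

definition seed_restricts :: "nat \<Rightarrow> nat set \<Rightarrow> nat set \<Rightarrow>
    (nat \<Rightarrow> nat \<Rightarrow> int) \<times> (nat \<Rightarrow> 'a::field) \<Rightarrow> (nat \<Rightarrow> nat \<Rightarrow> int) \<times> (nat \<Rightarrow> 'a) \<Rightarrow> bool" where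
  "seed_restricts r N' N s' s \<longleftrightarrow>
     (\<forall>i\<in>N. snd s' i = snd s i \<and> (\<forall>j\<in>{1..r}. fst s' i j = fst s i j)) \<and> (\<forall>i\<in>N' - N. snd s' i = 1)"

lemma seed_restricts_exchange_sum:
  assumes N: "finite N'" "N \<subseteq> N'" and k: "k \<in> {1..r}" and rs: "seed_restricts r N' N s' s"
  shows "exchange_sum N' k (fst s') (snd s') = exchange_sum N k (fst s) (snd s)"
proof -
  have "(\<Prod>i\<in>N'. snd s' i ^ nat (fst s' i k)) = (\<Prod>i\<in>N. snd s i ^ nat (fst s i k))"
    and "(\<Prod>i\<in>N'. snd s' i ^ nat (- fst s' i k)) = (\<Prod>i\<in>N. snd s i ^ nat (- fst s i k))"
    using N k rs unfolding seed_restricts_def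
    by (auto intro!: prod.mono_neutral_cong_right)
  then show ?thesis
    unfolding exchange_sum_def by simp
qed

lemma seed_restricts_step:
  assumes N: "finite N'" "N \<subseteq> N'" and r: "{1..r} \<subseteq> N" and k: "k \<in> {1..r}"
    and rs: "seed_restricts r N' N s' s"
  shows "seed_restricts r N' N (seed_step N' k s') (seed_step N k s)"
  using seed_restricts_exchange_sum[OF N k rs] rs r k
  unfolding seed_restricts_def by (auto simp: seed_step_def mutate_exch_def)

lemma seed_restricts_run:
  assumes "finite N'" "N \<subseteq> N'" "{1..r} \<subseteq> N" "set ks \<subseteq> {1..r}" "seed_restricts r N' N s' s"
  shows "seed_restricts r N' N (seed_run N' ks s') (seed_run N ks s)"
  using assms by (induction ks arbitrary: s s') (simp_all add: seed_restricts_step)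

lemma mutate_exch_uminus: "mutate_exch k (\<lambda>i j. - b i j) = (\<lambda>i j. - mutate_exch k b i j)"
  by (intro ext) (simp add: mutate_exch_def)

text \<open>A global sign change only swaps the two monomials. This later allows the sign of one
  matrix entry to be normalized.\<close>

lemma seed_step_uminus:
  "seed_step N k (\<lambda>i j. - b i j, x) =
     (\<lambda>i j. - fst (seed_step N k (b, x)) i j, snd (seed_step N k (b, x)))"
  by (simp add: seed_step_def exchange_sum_def mutate_exch_uminus add.commute)


section \<open>Dependence on one frozen variable\<close>

text \<open>Nonnegative coefficients rule out cancellation, and the positive constant coefficient
  rules out a zero at 0.\<close>

definition positive_polys :: "real set \<Rightarrow> real poly set" where
  "positive_polys R = {p \<in> polys_over R. (\<forall>n. coeff p n \<ge> 0) \<and> coeff p 0 > 0}"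

lemma positive_polys_mult:
  assumes "is_subring R" "p \<in> positive_polys R" "q \<in> positive_polys R"
  shows "p * q \<in> positive_polys R"
  using assms polys_over_mult[of R p q]
  by (auto simp: positive_polys_def coeff_mult intro!: sum_nonneg)

lemma positive_polys_add_monom:
  assumes R: "is_subring R" and p: "p \<in> positive_polys R" and q: "q \<in> positive_polys R"
  shows "p + monom 1 e * q \<in> positive_polys R"
proof -
  have "monom 1 e \<in> polys_over R"
    using R by (auto simp: polys_over_def is_subring_zero is_subring_one)
  then have "p + monom 1 e * q \<in> polys_over R"
    using p q R by (auto simp: positive_polys_def intro: polys_over_add polys_over_mult)
  then show ?thesis
    using p q by (auto simp: positive_polys_def coeff_monom_mult intro: add_pos_nonneg)
qed

lemma poly_positive_polys:
  assumes "p \<in> positive_polys R" "y \<ge> 0"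
  shows "poly p y > 0"
proof -
  have "(\<Sum>i\<in>{0}. coeff p i * y ^ i) \<le> (\<Sum>i\<le>degree p. coeff p i * y ^ i)"
    using assms by (intro sum_mono2) (auto simp: positive_polys_def)
  then show ?thesis
    using assms by (simp add: poly_altdef positive_polys_def)
qed

text \<open>Quotients of polynomials with nonnegative coefficients: no cancellation occurs, so neither
  the variable nor any positive number is a zero or a pole.\<close>

definition positive_fracs :: "real set \<Rightarrow> (real \<Rightarrow> real) set" where
  "positive_fracs R =
     {f. \<exists>p\<in>positive_polys R. \<exists>q\<in>positive_polys R. \<forall>y>0. f y = poly p y / poly q y}"

lemma positive_fracsI:
  "p \<in> positive_polys R \<Longrightarrow> q \<in> positive_polys R \<Longrightarrow> (\<And>y. y > 0 \<Longrightarrow> f y = poly p y / poly q y) \<Longrightarrow>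
   f \<in> positive_fracs R"
  unfolding positive_fracs_def by blast

lemma positive_fracsE:
  assumes "f \<in> positive_fracs R"
  obtains p q where "p \<in> positive_polys R" "q \<in> positive_polys R"
    "\<And>y. y > 0 \<Longrightarrow> f y = poly p y / poly q y"
  using assms unfolding positive_fracs_def by blast

lemma positive_fracs_const:
  assumes "is_subring R" "c \<in> R" "c > 0"
  shows "(\<lambda>_. c) \<in> positive_fracs R"
proof (rule positive_fracsI)
  show "[:c:] \<in> positive_polys R" "[:1:] \<in> positive_polys R"
    using assms polys_over_const[of R]
    by (auto simp: positive_polys_def is_subring_one coeff_pCons split: nat.split)
qed simp

lemma positive_fracs_mult:
  assumes R: "is_subring R" and f: "f \<in> positive_fracs R" and g: "g \<in> positive_fracs R"
  shows "(\<lambda>y. f y * g y) \<in> positive_fracs R"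
proof -
  obtain p q p' q' where
    "p \<in> positive_polys R" "q \<in> positive_polys R" "\<And>y. y > 0 \<Longrightarrow> f y = poly p y / poly q y"
    "p' \<in> positive_polys R" "q' \<in> positive_polys R" "\<And>y. y > 0 \<Longrightarrow> g y = poly p' y / poly q' y"
    by (rule positive_fracsE[OF f], rule positive_fracsE[OF g]) blast
  then show ?thesis
    using R by (intro positive_fracsI[of "p * p'" R "q * q'"]) (auto intro: positive_polys_mult)
qed

lemma positive_fracs_divide:
  assumes R: "is_subring R" and f: "f \<in> positive_fracs R" and g: "g \<in> positive_fracs R"
  shows "(\<lambda>y. f y / g y) \<in> positive_fracs R"
proof -
  obtain p q p' q' where
    "p \<in> positive_polys R" "q \<in> positive_polys R" "\<And>y. y > 0 \<Longrightarrow> f y = poly p y / poly q y"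
    "p' \<in> positive_polys R" "q' \<in> positive_polys R" "\<And>y. y > 0 \<Longrightarrow> g y = poly p' y / poly q' y"
    by (rule positive_fracsE[OF f], rule positive_fracsE[OF g]) blast
  then show ?thesis
    using R by (intro positive_fracsI[of "p * q'" R "q * p'"]) (auto intro: positive_polys_mult)
qed

lemma positive_fracs_add_power:
  assumes R: "is_subring R" and f: "f \<in> positive_fracs R" and g: "g \<in> positive_fracs R"
  shows "(\<lambda>y. f y + y ^ e * g y) \<in> positive_fracs R"
proof -
  obtain p q p' q' where *:
    "p \<in> positive_polys R" "q \<in> positive_polys R" "\<And>y. y > 0 \<Longrightarrow> f y = poly p y / poly q y"
    "p' \<in> positive_polys R" "q' \<in> positive_polys R" "\<And>y. y > 0 \<Longrightarrow> g y = poly p' y / poly q' y"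
    by (rule positive_fracsE[OF f], rule positive_fracsE[OF g]) blast
  show ?thesis
  proof (rule positive_fracsI)
    show "p * q' + monom 1 e * (p' * q) \<in> positive_polys R" "q * q' \<in> positive_polys R"
      using R * by (auto intro: positive_polys_mult positive_polys_add_monom)
    fix y :: real assume "y > 0"
    then show "f y + y ^ e * g y = poly (p * q' + monom 1 e * (p' * q)) y / poly (q * q') y"
      using poly_positive_polys[OF *(2), of y] poly_positive_polys[OF *(5), of y] *(3,6)
      by (simp add: poly_monom field_simps)
  qed
qed

lemma positive_fracs_prod_power:
  assumes "is_subring R" "\<And>i. i \<in> I \<Longrightarrow> f i \<in> positive_fracs R"
  shows "(\<lambda>y. \<Prod>i\<in>I. f i y ^ e i) \<in> positive_fracs R"
proof -
  have one: "(\<lambda>_. 1) \<in> positive_fracs R"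
    using assms by (intro positive_fracs_const is_subring_one) auto
  have pow: "(\<lambda>y. f i y ^ n) \<in> positive_fracs R" if "i \<in> I" for i n
    using that assms one by (induction n) (auto intro: positive_fracs_mult)
  show ?thesis
    using assms(2) pow
    by (induction I rule: infinite_finite_induct) (auto intro: positive_fracs_mult[OF assms(1)] one)
qed

text \<open>At most one of the two monomials of an exchange relation involves a given variable.\<close>

lemma seed_run_positive_fracs:
  fixes x :: "nat \<Rightarrow> real"
  assumes R: "is_subring R" and N: "finite N" "w \<in> N" "{1..r} \<subseteq> N - {w}"
    and x: "\<And>i. i \<in> N - {w} \<Longrightarrow> x i \<in> R \<and> x i > 0" and ks: "set ks \<subseteq> {1..r}" and i: "i \<in> N - {w}"
  shows "(\<lambda>y. snd (seed_run N ks (b, x(w := y))) i) \<in> positive_fracs R"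
  using ks i
proof (induction ks arbitrary: i rule: rev_induct)
  case Nil
  then show ?case
    using positive_fracs_const[OF R] x by auto
next
  case (snoc k ks)
  define c where "c = fold mutate_exch ks b"
  define f where "f = (\<lambda>i y. snd (seed_run N ks (b, x(w := y))) i)"
  have f: "f i \<in> positive_fracs R" if "i \<in> N - {w}" for i
    unfolding f_def using snoc.prems(1) by (intro snoc.IH[OF _ that]) simp
  have fw: "f w y = y" for y
    unfolding f_def using snoc.prems N(3) by (subst snd_seed_run_frozen) auto
  have split: "(\<Prod>i\<in>N. f i y ^ e i) = y ^ e w * (\<Prod>i\<in>N - {w}. f i y ^ e i)" for y e
    using N fw by (simp add: prod.remove[of N w])
  have P: "(\<lambda>y. \<Prod>i\<in>N - {w}. f i y ^ e i) \<in> positive_fracs R" for e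
    by (rule positive_fracs_prod_power[OF R f])
  \<comment> \<open>The sign of \<open>c w k\<close> decides which monomial carries the power of
    \<open>y\<close>; in the other one \<open>nat\<close> makes the exponent of \<open>y\<close>
    vanish.\<close>
  have "exchange_sum N k c (\<lambda>i. f i y) =
      (if c w k \<ge> 0
       then (\<Prod>i\<in>N - {w}. f i y ^ nat (- c i k)) + y ^ nat (c w k) * (\<Prod>i\<in>N - {w}. f i y ^ nat (c i k))
       else (\<Prod>i\<in>N - {w}. f i y ^ nat (c i k)) + y ^ nat (- c w k) * (\<Prod>i\<in>N - {w}. f i y ^ nat (- c i k)))"
    for y
    unfolding exchange_sum_def split[of y "\<lambda>i. nat (c i k)"] split[of y "\<lambda>i. nat (- c i k)"] by simp
  then have "(\<lambda>y. exchange_sum N k c (\<lambda>i. f i y)) \<in> positive_fracs R"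
    using positive_fracs_add_power[OF R P P] by (cases "c w k \<ge> 0") simp_all
  moreover have "k \<in> N - {w}"
    using snoc.prems N by auto
  ultimately have "(\<lambda>y. exchange_sum N k c (\<lambda>i. f i y) / f k y) \<in> positive_fracs R"
    using positive_fracs_divide[OF R _ f] by blast
  moreover have "(\<lambda>y. snd (seed_run N (ks @ [k]) (b, x(w := y))) i) =
      (if i = k then (\<lambda>y. exchange_sum N k c (\<lambda>i. f i y) / f k y) else f i)"
    by (intro ext) (simp add: seed_step_def fst_seed_run c_def f_def)
  ultimately show ?case
    using f[OF snoc.prems(2)] by (simp only: split: if_split) blast
qed

text \<open>Transcendence turns the Laurent expression at \<open>v\<close> into an identity
  \<open>X^n p = g q\<close> of polynomials. Since \<open>q\<close> has nonzero constant
  coefficient, \<open>X^n\<close> divides \<open>g\<close>; so \<open>p / q\<close> is a polynomial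
  over \<open>R\<close> and may be evaluated at any positive number.\<close>

lemma positive_fracs_laurent_over:
  assumes R: "is_subring R" and v: "transcendental_over R v" "v > 0"
    and f: "f \<in> positive_fracs R" and fv: "f v \<in> laurent_over R v"
  obtains g where "g \<in> polys_over R" "\<And>y. y > 0 \<Longrightarrow> f y = poly g y"
proof -
  obtain p q where pq: "p \<in> positive_polys R" "q \<in> positive_polys R"
    and f_eq: "\<And>y. y > 0 \<Longrightarrow> f y = poly p y / poly q y"
    using f by (rule positive_fracsE) blast
  obtain g n where g: "g \<in> polys_over R" "v ^ n * f v = poly g v"
    using fv by (rule laurent_overE)
  have "monom 1 n \<in> polys_over R"
    using R by (auto simp: polys_over_def is_subring_zero is_subring_one)
  then have "monom 1 n * p \<in> polys_over R" "g * q \<in> polys_over R"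
    using R pq g by (auto simp: positive_polys_def intro: polys_over_mult)
  moreover have "poly (monom 1 n * p) v = poly (g * q) v"
    using g(2) f_eq[OF v(2)] poly_positive_polys[OF pq(2), of v] v(2)
    by (simp add: poly_monom field_simps)
  ultimately have "monom 1 n * p = g * q"
    using R v by (intro transcendental_over_eqD) auto
  with g(1) have "\<exists>h\<in>polys_over R. p = h * q"
  proof (induction n arbitrary: g)
    case 0
    then show ?case by (auto simp: monom_0)
  next
    case (Suc n)
    have eq: "pCons 0 (monom 1 n * p) = g * q"
      using Suc.prems by (simp add: monom_Suc)
    then have "coeff (g * q) 0 = 0"
      by (metis coeff_pCons_0)
    then have "coeff g 0 = 0"
      using pq(2) by (simp add: coeff_mult positive_polys_def)
    then obtain g' where g': "g = pCons 0 g'"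
      by (metis coeff_pCons_0 pCons_cases)
    show ?case
      using eq Suc.prems(1) by (intro Suc.IH[of g']) (auto simp: g' polys_over_pCons)
  qed
  then obtain h where h: "h \<in> polys_over R" "p = h * q"
    by blast
  show thesis
  proof (rule that[OF h(1)])
    fix y :: real assume "y > 0"
    then show "f y = poly h y"
      using f_eq[of y] h(2) poly_positive_polys[OF pq(2), of y] by simp
  qed
qed


section \<open>Integrality of numerical mutations\<close>

text \<open>With \<open>z\<^sub>1, z\<^sub>2, z\<^sub>3\<close> the new cluster entries of three successive mutations in the
  directions \<open>j, k, j\<close>, both \<open>z\<^sub>2\<close> and \<open>z\<^sub>3\<close> are polynomials in the frozen variable \<open>v\<close> whose
  constant coefficients are monomials.\<close>

lemma three_exchange_relations:
  fixes z\<^sub>1 z\<^sub>2 z\<^sub>3 u\<^sub>j u\<^sub>k A B C D C' D' v :: real and n c :: nat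
  defines "g\<^sub>2 \<equiv> [:B / u\<^sub>k, z\<^sub>1 ^ n * A / u\<^sub>k:]"
  defines "g\<^sub>3 \<equiv> [:D' * u\<^sub>j / (C * u\<^sub>k ^ c):] +
    [:0, z\<^sub>1 ^ (n - 1) * A * C' / u\<^sub>k:] * (\<Sum>i<c. [:(B / u\<^sub>k) ^ (c - Suc i):] * g\<^sub>2 ^ i)"
  assumes nz: "z\<^sub>1 \<noteq> 0" "u\<^sub>k \<noteq> 0" "C \<noteq> 0"
    and z\<^sub>1: "z\<^sub>1 * u\<^sub>j = u\<^sub>k ^ c * C + D"
    and z\<^sub>2: "z\<^sub>2 * u\<^sub>k = z\<^sub>1 ^ n * A * v + B"
    and z\<^sub>3: "z\<^sub>3 * z\<^sub>1 = z\<^sub>2 ^ c * C' + D'"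
    and BCD: "B ^ c * C' * C = D * D'"
    and cn: "c = 0 \<or> n > 0"
  shows "poly g\<^sub>2 v = z\<^sub>2" "poly g\<^sub>3 v = z\<^sub>3"
proof -
  show g\<^sub>2: "poly g\<^sub>2 v = z\<^sub>2"
    using z\<^sub>2 nz by (simp add: g\<^sub>2_def field_simps)
  \<comment> \<open>\<open>X\<close> is the constant coefficient of \<open>g\<^sub>2\<close>.
    Splitting \<open>z\<^sub>2 ^ c\<close> into \<open>X ^ c\<close> and a multiple of
    \<open>z\<^sub>2 - X\<close> isolates a part divisible by \<open>z\<^sub>1\<close>.\<close>
  define X where "X = B / u\<^sub>k"
  define S where "S = (\<Sum>i<c. X ^ (c - Suc i) * z\<^sub>2 ^ i)"
  have "z\<^sub>2 ^ c - X ^ c = (z\<^sub>2 - X) * S"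
    unfolding S_def by (rule power_diff_sumr2)
  also have "z\<^sub>2 - X = z\<^sub>1 ^ n * A * v / u\<^sub>k"
    using z\<^sub>2 nz by (simp add: X_def field_simps)
  finally have "C' * (z\<^sub>2 ^ c - X ^ c) = z\<^sub>1 ^ n * A * v / u\<^sub>k * S * C'"
    by simp
  \<comment> \<open>By \<open>cn\<close>, either \<open>S\<close> is an empty sum or
    \<open>n > 0\<close>, and then a factor \<open>z\<^sub>1\<close> splits off and
    \<open>n - 1\<close> is a true predecessor.\<close>
  also have "\<dots> = z\<^sub>1 * (v * (z\<^sub>1 ^ (n - 1) * A * C' / u\<^sub>k) * S)"
  proof (cases "c = 0")
    case False
    then have "z\<^sub>1 ^ n = z\<^sub>1 * z\<^sub>1 ^ (n - 1)"
      using cn by (cases n) auto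
    then show ?thesis
      by simp
  qed (simp add: S_def)
  finally have 1: "C' * (z\<^sub>2 ^ c - X ^ c) = z\<^sub>1 * (v * (z\<^sub>1 ^ (n - 1) * A * C' / u\<^sub>k) * S)" .
  have "X ^ c * C' = D * D' / (C * u\<^sub>k ^ c)"
    using BCD nz by (simp add: X_def field_simps)
  \<comment> \<open>What remains at \<open>v = 0\<close> is \<open>D' + X ^ c * C'\<close>; by
    \<open>BCD\<close> it is \<open>D' / (C * u\<^sub>k ^ c)\<close> times the right-hand side of
    the first exchange relation, hence divisible by \<open>z\<^sub>1\<close> with a monomial
    quotient.\<close>
  then have 2: "z\<^sub>1 * (D' * u\<^sub>j / (C * u\<^sub>k ^ c)) = D' + X ^ c * C'"
  proof -
    have "z\<^sub>1 * (D' * u\<^sub>j / (C * u\<^sub>k ^ c)) = (z\<^sub>1 * u\<^sub>j) * D' / (C * u\<^sub>k ^ c)"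
      by simp
    also have "\<dots> = D' + D * D' / (C * u\<^sub>k ^ c)"
      unfolding z\<^sub>1 using nz by (simp add: field_simps)
    finally show ?thesis
      using \<open>X ^ c * C' = D * D' / (C * u\<^sub>k ^ c)\<close> by simp
  qed
  have "poly g\<^sub>3 v = D' * u\<^sub>j / (C * u\<^sub>k ^ c) + v * (z\<^sub>1 ^ (n - 1) * A * C' / u\<^sub>k) * S"
    by (simp add: g\<^sub>3_def g\<^sub>2 S_def X_def poly_sum)
  then have "z\<^sub>1 * poly g\<^sub>3 v = D' + X ^ c * C' + C' * (z\<^sub>2 ^ c - X ^ c)"
    unfolding 1 by (simp only: distrib_left 2)
  also have "\<dots> = z\<^sub>1 * z\<^sub>3"
    using z\<^sub>3 by (simp add: algebra_simps)
  finally show "poly g\<^sub>3 v = z\<^sub>3"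
    using nz by simp
qed

text \<open>The entry 1 of row \<open>w\<close> puts \<open>v\<close> into the same monomial of the
  second exchange as \<open>z\<^sub>1\<close>. The other monomial is thus free of both, so the
  constant coefficient in \<open>v\<close> is a monomial in the initial entries, a unit. In
  \<open>s\<^sub>3\<close> the value \<open>z\<^sub>1\<close> has been overwritten.\<close>

lemma seed_step_neighbours_nonneg:
  fixes x :: "nat \<Rightarrow> real"
  assumes R: "is_subring R" and N: "finite N" "{1..r} \<subseteq> N" "w \<notin> N"
    and skew: "skew_symmetrizable r b" and jk: "j \<in> {1..r}" "k \<in> {1..r}" "j \<noteq> k"
    and bkj: "b k j \<ge> 0" and bw: "b w j = 0" "b w k = 1"
    and x: "\<And>i. i \<in> N \<Longrightarrow> x i > 0 \<and> unit_in R (x i)" and v: "v > 0"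
  defines "s\<^sub>1 \<equiv> seed_step (insert w N) j (b, x(w := v))"
  defines "s\<^sub>3 \<equiv> seed_step (insert w N) j (seed_step (insert w N) k s\<^sub>1)"
  shows "\<exists>z g\<^sub>2 g\<^sub>3. z \<in> R \<and> z > 0 \<and> snd s\<^sub>1 = x(w := v, j := z) \<and>
    snd s\<^sub>3 = x(w := v, k := poly g\<^sub>2 v, j := poly g\<^sub>3 v) \<and>
    (\<forall>g\<in>{g\<^sub>2, g\<^sub>3}. g \<in> polys_over R \<and> unit_in R (coeff g 0) \<and> coeff g 0 \<noteq> 0)"
proof -
  define K where "K = N - {j, k}"
  define b' where "b' = mutate_exch j b"
  define b'' where "b'' = mutate_exch k b'"
  define mono where "mono f = (\<Prod>i\<in>K. x i ^ f i)" for f :: "nat \<Rightarrow> nat"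
  have jN: "j \<in> N" and kN: "k \<in> N" and w: "w \<noteq> j" "w \<noteq> k"
    using jk N by auto
  \<comment> \<open>Only the indices \<open>w\<close>, \<open>j\<close>, \<open>k\<close> need
    attention; all entries in \<open>K\<close> keep their initial values through the three
    mutations.\<close>
  have split: "(\<Prod>i\<in>insert w N. y i ^ f i) = y w ^ f w * (y j ^ f j * (y k ^ f k * mono f))"
    if "\<And>i. i \<in> K \<Longrightarrow> y i = x i" for y :: "nat \<Rightarrow> real" and f
  proof -
    have eq: "insert w N = insert w (insert j (insert k K))"
      using jN kN by (auto simp: K_def)
    have "finite K" "w \<notin> insert j (insert k K)" "j \<notin> insert k K" "k \<notin> K"
      using N w jk by (auto simp: K_def)
    then have "(\<Prod>i\<in>insert w N. y i ^ f i) = y w ^ f w * (y j ^ f j * (y k ^ f k * (\<Prod>i\<in>K. y i ^ f i)))"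
      unfolding eq by simp
    also have "(\<Prod>i\<in>K. y i ^ f i) = mono f"
      unfolding mono_def using that by (intro prod.cong) auto
    finally show ?thesis .
  qed
  have mono_unit: "unit_in R (mono f)" for f
    unfolding mono_def using R x by (intro unit_in_prod unit_in_power) (auto simp: K_def)
  have mono_pos: "mono f > 0" for f
    unfolding mono_def using x by (intro prod_pos) (auto simp: K_def)
  \<comment> \<open>\<open>c\<close> is the exponent of entry \<open>k\<close> in both exchanges at
    \<open>j\<close>, and \<open>n\<close> that of \<open>z\<^sub>1\<close> in the exchange at
    \<open>k\<close>. Opposite signs of \<open>b j k\<close> and \<open>b k j\<close> give
    \<open>cn\<close>.\<close>
  define c where "c = nat (b k j)"
  define n where "n = nat (b' j k)"
  have bjk: "b j k \<le> 0" and cn: "c = 0 \<or> n > 0"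
    using skew_symmetrizable_sgn[OF skew jk(1,2)] skew_symmetrizable_sgn[OF skew jk(2,1)] bkj
    by (auto simp: c_def n_def b'_def mutate_exch_def)
  have b: "b j j = 0" "b k k = 0"
    using skew jk by (auto intro: skew_symmetrizable_diag)
  have b': "b' j j = 0" "b' k k = 0" "b' k j = - b k j" "b' j k = - b j k" "b' w j = 0" "b' w k = 1"
    using b bw w jk bkj bjk by (auto simp: b'_def mutate_exch_def pos_part_def)
  have b'': "b'' j j = 0" "b'' k j = b k j" "b'' w j = 0"
    using b' w jk bkj bjk by (auto simp: b''_def mutate_exch_def pos_part_def)
  \<comment> \<open>The parts of the exchange monomials supported on \<open>K\<close>:
    \<open>C\<close>, \<open>D\<close> for the first mutation at \<open>j\<close>, then
    \<open>A\<close>, \<open>B\<close> at \<open>k\<close>, then \<open>C'\<close>,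
    \<open>D'\<close> for the second at \<open>j\<close>.\<close>
  define A where "A = mono (\<lambda>i. nat (b' i k))"
  define B where "B = mono (\<lambda>i. nat (- b' i k))"
  define C where "C = mono (\<lambda>i. nat (b i j))"
  define D where "D = mono (\<lambda>i. nat (- b i j))"
  define C' where "C' = mono (\<lambda>i. nat (b'' i j))"
  define D' where "D' = mono (\<lambda>i. nat (- b'' i j))"
  define z\<^sub>1 where "z\<^sub>1 = (x k ^ c * C + D) / x j"
  define z\<^sub>2 where "z\<^sub>2 = (z\<^sub>1 ^ n * A * v + B) / x k"
  define z\<^sub>3 where "z\<^sub>3 = (z\<^sub>2 ^ c * C' + D') / z\<^sub>1"
  have xjk: "x j > 0" "x k > 0" "unit_in R (x j)" "unit_in R (x k)"
    using x jN kN by auto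
  have z\<^sub>1: "z\<^sub>1 > 0"
    using xjk mono_pos by (simp add: z\<^sub>1_def C_def D_def add_pos_pos)
  have s\<^sub>1: "s\<^sub>1 = (b', x(w := v, j := z\<^sub>1))"
    unfolding s\<^sub>1_def seed_step_def exchange_sum_def
    using jk w b bw bkj
    by (subst (1 2) split)
       (auto simp: K_def b'_def z\<^sub>1_def c_def C_def D_def N(3))
  have s\<^sub>2: "seed_step (insert w N) k s\<^sub>1 = (b'', x(w := v, j := z\<^sub>1, k := z\<^sub>2))"
    unfolding s\<^sub>1 seed_step_def exchange_sum_def
    using jk w b' bkj bjk
    by (subst (1 2) split)
       (auto simp: K_def b''_def z\<^sub>2_def n_def A_def B_def N(3) mult_ac)
  have s\<^sub>3: "snd s\<^sub>3 = x(w := v, k := z\<^sub>2, j := z\<^sub>3)"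
    unfolding s\<^sub>3_def s\<^sub>2 unfolding seed_step_def exchange_sum_def
    using jk w b'' bkj
    by (subst (1 2) split)
       (auto simp: K_def z\<^sub>3_def c_def C'_def D'_def N(3) fun_upd_twist)
  \<comment> \<open>This is the exponent of \<open>x i\<close> on both sides of \<open>BCD\<close>.
    Mutation at \<open>k\<close> makes \<open>b'' i j + b i j\<close> equal to
    \<open>- c * nat (- b' i k)\<close>, and each entry is the difference of its positive and
    negative parts.\<close>
  have "c * nat (- b' i k) + nat (b'' i j) + nat (b i j) = nat (- b i j) + nat (- b'' i j)"
    if "i \<in> K" for i
  proof -
    have "b'' i j = - b i j - b k j * pos_part (- b' i k)"
      using that jk bkj b' by (auto simp: K_def b''_def b'_def mutate_exch_def pos_part_def)
    then have "b'' i j = - b i j - int (c * nat (- b' i k))"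
      using bkj by (simp add: c_def pos_part_def max_def)
    then show ?thesis
      by linarith
  qed
  then have "mono (\<lambda>i. nat (- b' i k) * c + nat (b'' i j) + nat (b i j)) =
      mono (\<lambda>i. nat (- b i j) + nat (- b'' i j))"
    unfolding mono_def by (intro prod.cong) (simp_all only: mult.commute)
  then have BCD: "B ^ c * C' * C = D * D'"
    unfolding B_def C'_def C_def D_def D'_def
    by (simp only: mono_def power_add prod.distrib power_mult prod_power_distrib)
  define g\<^sub>2 where "g\<^sub>2 = [:B / x k, z\<^sub>1 ^ n * A / x k:]"
  define g\<^sub>3 where "g\<^sub>3 = [:D' * x j / (C * x k ^ c):] +
    [:0, z\<^sub>1 ^ (n - 1) * A * C' / x k:] * (\<Sum>i<c. [:(B / x k) ^ (c - Suc i):] * g\<^sub>2 ^ i)"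
  have rels: "z\<^sub>1 \<noteq> 0" "x k \<noteq> 0" "C \<noteq> 0" "z\<^sub>1 * x j = x k ^ c * C + D"
    "z\<^sub>2 * x k = z\<^sub>1 ^ n * A * v + B" "z\<^sub>3 * z\<^sub>1 = z\<^sub>2 ^ c * C' + D'"
    using z\<^sub>1 xjk mono_pos[of "\<lambda>i. nat (b i j)"]
    by (auto simp: z\<^sub>1_def[symmetric] z\<^sub>3_def z\<^sub>2_def C_def) (simp add: z\<^sub>1_def C_def)
  have polys: "poly g\<^sub>2 v = z\<^sub>2" "poly g\<^sub>3 v = z\<^sub>3"
    unfolding g\<^sub>3_def g\<^sub>2_def using three_exchange_relations[OF rels BCD cn] by blast+
  have units: "unit_in R A" "unit_in R B" "unit_in R C" "unit_in R D" "unit_in R C'" "unit_in R D'"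
    unfolding A_def B_def C_def D_def C'_def D'_def by (rule mono_unit)+
  have nz: "B \<noteq> 0" "C \<noteq> 0" "D' \<noteq> 0"
    unfolding B_def C_def D'_def using mono_pos less_irrefl by metis+
  have mem: "a \<in> R" if "unit_in R a" for a
    using that by (simp add: unit_in_def)
  have z\<^sub>1R: "z\<^sub>1 \<in> R"
    unfolding z\<^sub>1_def divide_inverse
    using R mem units xjk unit_in_inverse
    by (intro is_subring_mult is_subring_add is_subring_power) auto
  have Bk: "unit_in R (B / x k)"
    using R units xjk by (intro unit_in_divide)
  have "z\<^sub>1 ^ n * A / x k \<in> R" "z\<^sub>1 ^ (n - 1) * A * C' / x k \<in> R"
    unfolding divide_inverse using R mem units xjk z\<^sub>1R unit_in_inverse
    by (auto intro!: is_subring_mult is_subring_power)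
  then have g\<^sub>2: "g\<^sub>2 \<in> polys_over R" and
    q: "[:0, z\<^sub>1 ^ (n - 1) * A * C' / x k:] \<in> polys_over R"
    using R mem[OF Bk] by (auto simp: g\<^sub>2_def polys_over_pCons polys_over_zero is_subring_zero)
  have e: "unit_in R (D' * x j / (C * x k ^ c))"
    using R units xjk by (intro unit_in_divide unit_in_mult unit_in_power)
  have g\<^sub>3: "g\<^sub>3 \<in> polys_over R"
    unfolding g\<^sub>3_def
    using R mem[OF e] mem[OF Bk] g\<^sub>2 q
    by (intro polys_over_add polys_over_mult polys_over_sum polys_over_power polys_over_const
        is_subring_power)
  have coeffs: "coeff g\<^sub>2 0 = B / x k" "coeff g\<^sub>3 0 = D' * x j / (C * x k ^ c)"
    by (simp_all add: g\<^sub>2_def g\<^sub>3_def coeff_mult)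
  show ?thesis
    using z\<^sub>1R z\<^sub>1 s\<^sub>1 s\<^sub>3 polys g\<^sub>2 g\<^sub>3 coeffs Bk e nz xjk
    by (intro exI[of _ z\<^sub>1] exI[of _ g\<^sub>2] exI[of _ g\<^sub>3]) auto
qed

text \<open>If \<open>b k j\<close> is negative, negating the matrix reduces to the other sign
  without changing the values; row \<open>w\<close> then has entry 1 in column \<open>k\<close>,
  whence the choice of sign in \<open>bw\<close>.\<close>

lemma seed_step_neighbours:
  fixes x :: "nat \<Rightarrow> real"
  assumes R: "is_subring R" and N: "finite N" "{1..r} \<subseteq> N" "w \<notin> N"
    and skew: "skew_symmetrizable r b" and jk: "j \<in> {1..r}" "k \<in> {1..r}" "j \<noteq> k"
    and bw: "b w j = 0" "b w k = (if b k j \<ge> 0 then 1 else - 1)"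
    and x: "\<And>i. i \<in> N \<Longrightarrow> x i > 0 \<and> unit_in R (x i)" and v: "v > 0"
  defines "s\<^sub>1 \<equiv> seed_step (insert w N) j (b, x(w := v))"
  defines "s\<^sub>3 \<equiv> seed_step (insert w N) j (seed_step (insert w N) k s\<^sub>1)"
  shows "\<exists>z g\<^sub>2 g\<^sub>3. z \<in> R \<and> z > 0 \<and> snd s\<^sub>1 = x(w := v, j := z) \<and>
    snd s\<^sub>3 = x(w := v, k := poly g\<^sub>2 v, j := poly g\<^sub>3 v) \<and>
    (\<forall>g\<in>{g\<^sub>2, g\<^sub>3}. g \<in> polys_over R \<and> unit_in R (coeff g 0) \<and> coeff g 0 \<noteq> 0)"
proof (cases "b k j \<ge> 0")
  case True
  then show ?thesis
    unfolding s\<^sub>1_def s\<^sub>3_def using assms by (intro seed_step_neighbours_nonneg) auto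
next
  case False
  obtain d :: "nat \<Rightarrow> int" where "\<forall>i\<in>{1..r}. d i > 0"
    and d: "\<forall>i\<in>{1..r}. \<forall>j\<in>{1..r}. d i * b i j = - (d j * b j i)"
    using skew unfolding skew_symmetrizable_def by blast
  moreover have "\<forall>i\<in>{1..r}. \<forall>j\<in>{1..r}. d i * - b i j = - (d j * - b j i)"
    using d by fastforce
  ultimately have "skew_symmetrizable r (\<lambda>i j. - b i j)"
    unfolding skew_symmetrizable_def by blast
  moreover have "snd (seed_step (insert w N) j (\<lambda>i j. - b i j, x(w := v))) = snd s\<^sub>1"
    by (simp add: seed_step_uminus s\<^sub>1_def)
  moreover have "snd (seed_step (insert w N) j (seed_step (insert w N) k
      (seed_step (insert w N) j (\<lambda>i j. - b i j, x(w := v))))) = snd s\<^sub>3"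
    unfolding s\<^sub>1_def s\<^sub>3_def seed_step_uminus prod.collapse by simp
  ultimately show ?thesis
    using seed_step_neighbours_nonneg[OF R N, of "\<lambda>i j. - b i j" j k x v] jk bw False x v by simp
qed

text \<open>The numerical Laurent phenomenon. The induction on the number of mutations leaves
  \<open>R\<close>, \<open>N\<close>, \<open>b\<close> and \<open>x\<close> free, because the
  hypothesis is applied over localizations of R[v, 1/v] with one more frozen index.\<close>

lemma seed_run_mem_of_units:
  fixes x :: "nat \<Rightarrow> real"
  assumes "finite N" "{1..r} \<subseteq> N" "is_subring R" "countable R" "skew_symmetrizable r b"
    and "set ks \<subseteq> {1..r}" "\<And>i. i \<in> N \<Longrightarrow> x i > 0 \<and> unit_in R (x i)" "i \<in> N"
  shows "snd (seed_run N ks (b, x)) i \<in> R"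
  using assms
proof (induction "length ks" arbitrary: ks N R b x i rule: less_induct)
  case less
  note N = less.prems(1,2) and R = less.prems(3,4) and skew = less.prems(5) and x = less.prems(7)
  have xR: "x i \<in> R" if "i \<in> N" for i
    using x that by (auto simp: unit_in_def)
  \<comment> \<open>Two equal initial directions cancel by involutivity, so only words beginning
    with distinct \<open>j\<close>, \<open>k\<close> need the gluing argument.\<close>
  consider "ks = []" | k where "ks = [k]" | k ks' where "ks = k # k # ks'"
    | j k ks' where "ks = j # k # ks'" "j \<noteq> k"
    by (metis list.exhaust)
  then show ?case
  proof cases
    case 1
    then show ?thesis using xR less.prems(8) by simp
  next
    case (2 k)
    then have k: "k \<in> N"
      using less.prems(6) N by auto
    have "exchange_sum N k b x \<in> R"
      unfolding exchange_sum_def using R xR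
      by (intro is_subring_add is_subring_prod is_subring_power)
    moreover have "inverse (x k) \<in> R"
      using x k by (simp add: unit_in_def)
    ultimately have "exchange_sum N k b x / x k \<in> R"
      using R by (simp add: divide_inverse is_subring_mult)
    then show ?thesis
      using 2 xR less.prems(8) by (simp add: seed_step_def)
  next
    case (3 k ks')
    have k: "k \<in> {1..r}" "k \<in> N"
      using 3 less.prems(6) N by auto
    have "seed_step N k (seed_step N k (b, x)) = (b, x)"
    proof (rule seed_step_involution)
      show "b k k = 0"
        by (rule skew_symmetrizable_diag[OF skew k(1)])
      show "x k \<noteq> 0"
        using x[OF k(2)] by simp
      show "exchange_sum N k b x \<noteq> 0"
        using exchange_sum_pos[of N x k b] x by simp
    qed
    then have "seed_run N ks (b, x) = seed_run N ks' (b, x)"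
      using 3 by simp
    then show ?thesis
      using less 3 by simp
  next
    case (4 j k ks')
    have jk: "j \<in> {1..r}" "k \<in> {1..r}" "j \<noteq> k" and ks': "set ks' \<subseteq> {1..r}"
      using 4 less.prems(6) by auto
    have jkN: "j \<in> N" "k \<in> N"
      using jk N by auto
    obtain v where v: "v > 0" "transcendental_over R v"
      using exists_transcendental_over[OF R(2)] by blast
    obtain w where w: "w \<notin> N"
      using N(1) ex_new_if_finite infinite_UNIV_nat by blast
    then have w': "w \<notin> {1..r}" "w \<noteq> i"
      using N less.prems(8) by auto
    \<comment> \<open>The new row \<open>w\<close> vanishes outside column \<open>k\<close>; its
      sign follows \<open>b k j\<close> as \<open>seed_step_neighbours\<close> requires.\<close>
    define b' where "b' = b(w := (\<lambda>_. 0)(k := if b k j \<ge> 0 then 1 else - 1))"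
    have b': "b' i l = b i l" if "i \<in> N" for i l
      using that w by (auto simp: b'_def)
    have skew': "skew_symmetrizable r b'"
      using skew by (rule skew_symmetrizable_cong) (use w' in \<open>auto simp: b'_def\<close>)
    define N' where "N' = insert w N"
    define R' where "R' = laurent_over R v"
    define s\<^sub>1 where "s\<^sub>1 = seed_step N' j (b', x(w := v))"
    define s\<^sub>2 where "s\<^sub>2 = seed_step N' k s\<^sub>1"
    define s\<^sub>3 where "s\<^sub>3 = seed_step N' j s\<^sub>2"
    have N': "finite N'" "{1..r} \<subseteq> N'" "j \<in> N'" "k \<in> N'" "i \<in> N'"
      using N jkN less.prems(8) by (auto simp: N'_def)
    have R': "is_subring R'" "countable R'"
      unfolding R'_def using R v by (auto intro: is_subring_laurent_over countable_laurent_over)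
    have "\<exists>z g\<^sub>2 g\<^sub>3. z \<in> R \<and> z > 0 \<and> snd s\<^sub>1 = x(w := v, j := z) \<and>
      snd s\<^sub>3 = x(w := v, k := poly g\<^sub>2 v, j := poly g\<^sub>3 v) \<and>
      (\<forall>g\<in>{g\<^sub>2, g\<^sub>3}. g \<in> polys_over R \<and> unit_in R (coeff g 0) \<and> coeff g 0 \<noteq> 0)"
      unfolding s\<^sub>1_def s\<^sub>2_def s\<^sub>3_def N'_def
    proof (rule seed_step_neighbours[OF R(1) N w skew' jk])
      show "b' w j = 0" "b' w k = (if 0 \<le> b' k j then 1 else - 1)"
        using jk b'[OF jkN(2)] by (simp_all add: b'_def)
    qed (use x v in auto)
    then obtain z g\<^sub>2 g\<^sub>3 where z: "z \<in> R" "z > 0"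
      and s\<^sub>1: "snd s\<^sub>1 = x(w := v, j := z)"
      and s\<^sub>3: "snd s\<^sub>3 = x(w := v, k := poly g\<^sub>2 v, j := poly g\<^sub>3 v)"
      and g\<^sub>2: "g\<^sub>2 \<in> polys_over R" "unit_in R (coeff g\<^sub>2 0)" "coeff g\<^sub>2 0 \<noteq> 0"
      and g\<^sub>3: "g\<^sub>3 \<in> polys_over R" "unit_in R (coeff g\<^sub>3 0)" "coeff g\<^sub>3 0 \<noteq> 0"
      by blast
    have x': "x' i > 0 \<and> unit_in R' (x' i)" if "x' = x(w := v)" "i \<in> N'" for x' i
      using that x v R unit_in_laurent_over[OF R(1), of v] subset_laurent_over[OF R(1), of v]
        unit_in_mono[of R _ R']
      by (auto simp: N'_def R'_def)
    have pos\<^sub>1: "snd s\<^sub>1 i > 0" if "i \<in> N'" for i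
      unfolding s\<^sub>1_def using that x' N' by (intro seed_step_pos) auto
    have pos\<^sub>2: "snd s\<^sub>2 i > 0" if "i \<in> N'" for i
      unfolding s\<^sub>2_def using that pos\<^sub>1 N' by (intro seed_step_pos) auto
    have pos\<^sub>3: "snd s\<^sub>3 i > 0" if "i \<in> N'" for i
      unfolding s\<^sub>3_def using that pos\<^sub>2 N' by (intro seed_step_pos) auto
    have skew\<^sub>2: "skew_symmetrizable r (fst s\<^sub>2)"
      unfolding s\<^sub>2_def s\<^sub>1_def using skew' jk by (simp add: skew_symmetrizable_mutate_exch)

    define f where "f = (\<lambda>y. snd (seed_run N' ks (b', x(w := y))) i)"
    have zR': "z \<in> R'" "z \<noteq> 0"
      using z subset_laurent_over[OF R(1)] by (auto simp: R'_def)
    define R\<^sub>1 where "R\<^sub>1 = localization R' z"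
    \<comment> \<open>First route, from \<open>s\<^sub>1\<close>: its entries are units of
      \<open>R'\<close> except possibly \<open>z\<close>, so inverting \<open>z\<close>
      suffices.\<close>
    have "f v = snd (seed_run N' (k # ks') (fst s\<^sub>1, snd s\<^sub>1)) i"
      by (simp add: f_def 4 s\<^sub>1_def del: fst_seed_step)
    also have "\<dots> \<in> R\<^sub>1"
    proof (rule less.hyps)
      show "length (k # ks') < length ks" "set (k # ks') \<subseteq> {1..r}"
        using 4 jk ks' by auto
      show "is_subring R\<^sub>1" "countable R\<^sub>1"
        unfolding R\<^sub>1_def using R' zR'
        by (auto intro: is_subring_localization countable_localization)
      show "skew_symmetrizable r (fst s\<^sub>1)"
        unfolding s\<^sub>1_def using skew' jk by (simp add: skew_symmetrizable_mutate_exch)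
      fix l assume l: "l \<in> N'"
      have "unit_in R\<^sub>1 z"
        unfolding R\<^sub>1_def by (rule unit_in_localization[OF R'(1) zR'])
      moreover have "unit_in R\<^sub>1 ((x(w := v)) l)"
        unfolding R\<^sub>1_def using x'[OF refl l] subset_localization by (blast intro: unit_in_mono)
      ultimately show "snd s\<^sub>1 l > 0 \<and> unit_in R\<^sub>1 (snd s\<^sub>1 l)"
        using pos\<^sub>1[OF l] by (simp add: s\<^sub>1)
    qed (use N' in auto)
    finally have 1: "f v \<in> localization R' z"
      by (simp add: R\<^sub>1_def)

    \<comment> \<open>A single denominator for the two new entries of
      \<open>s\<^sub>3\<close>.\<close>
    define a where "a = poly g\<^sub>2 v * poly g\<^sub>3 v"
    have reg: "regular_mod R' z (poly g\<^sub>2 v)" "regular_mod R' z (poly g\<^sub>3 v)"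
      unfolding R'_def using R(1) v g\<^sub>2 g\<^sub>3 z by (auto intro!: regular_mod_laurent_over)
    have gR': "poly g\<^sub>2 v \<in> R'" "poly g\<^sub>3 v \<in> R'"
      unfolding R'_def using g\<^sub>2 g\<^sub>3 by (auto intro: poly_in_laurent_over)
    have "poly g\<^sub>2 v > 0" "poly g\<^sub>3 v > 0"
      using pos\<^sub>3[OF N'(3)] pos\<^sub>3[OF N'(4)] jk by (simp_all add: s\<^sub>3)
    then have a: "a \<noteq> 0" "a \<in> R'"
      using gR' R' by (auto simp: a_def is_subring_mult)
    define R\<^sub>3 where "R\<^sub>3 = localization R' a"
    \<comment> \<open>Second route: mutating \<open>s\<^sub>3\<close> back at \<open>j\<close> gives
      \<open>s\<^sub>2\<close>, so the word \<open>j # ks'\<close>, still shorter than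
      \<open>ks\<close>, leads from \<open>s\<^sub>3\<close> to the same final seed.\<close>
    have "seed_step N' j s\<^sub>3 = s\<^sub>2"
    proof -
      have "seed_step N' j (seed_step N' j (fst s\<^sub>2, snd s\<^sub>2)) = (fst s\<^sub>2, snd s\<^sub>2)"
      proof (rule seed_step_involution)
        show "fst s\<^sub>2 j j = 0"
          using skew_symmetrizable_diag[OF skew\<^sub>2 jk(1)] .
        show "snd s\<^sub>2 j \<noteq> 0"
          using pos\<^sub>2[OF N'(3)] by simp
        show "exchange_sum N' j (fst s\<^sub>2) (snd s\<^sub>2) \<noteq> 0"
          using exchange_sum_pos[of N' "snd s\<^sub>2" j "fst s\<^sub>2"] pos\<^sub>2 by simp
      qed
      then show ?thesis
        by (simp add: s\<^sub>3_def)
    qed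
    then have "f v = snd (seed_run N' (j # ks') (fst s\<^sub>3, snd s\<^sub>3)) i"
      by (simp add: f_def 4 s\<^sub>1_def s\<^sub>2_def del: fst_seed_step)
    also have "\<dots> \<in> R\<^sub>3"
    proof (rule less.hyps)
      show "length (j # ks') < length ks" "set (j # ks') \<subseteq> {1..r}"
        using 4 jk ks' by auto
      show "is_subring R\<^sub>3" "countable R\<^sub>3"
        unfolding R\<^sub>3_def using R' a
        by (auto intro: is_subring_localization countable_localization)
      show "skew_symmetrizable r (fst s\<^sub>3)"
        unfolding s\<^sub>3_def using skew\<^sub>2 jk by (simp add: skew_symmetrizable_mutate_exch)
      fix l assume l: "l \<in> N'"
      have "unit_in R\<^sub>3 (poly g\<^sub>2 v)"
        unfolding R\<^sub>3_def a_def
        by (rule unit_in_localization_factor) (use R' a gR' in \<open>auto simp: a_def\<close>)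
      moreover have "unit_in R\<^sub>3 (poly g\<^sub>3 v)"
        unfolding R\<^sub>3_def a_def mult.commute[of "poly g\<^sub>2 v"]
        by (rule unit_in_localization_factor) (use R' a gR' in \<open>auto simp: a_def\<close>)
      moreover have "unit_in R\<^sub>3 ((x(w := v)) l)"
        unfolding R\<^sub>3_def using x'[OF refl l] subset_localization by (blast intro: unit_in_mono)
      ultimately show "snd s\<^sub>3 l > 0 \<and> unit_in R\<^sub>3 (snd s\<^sub>3 l)"
        using pos\<^sub>3[OF l] by (simp add: s\<^sub>3)
    qed (use N' in auto)
    finally have "f v \<in> localization R' a"
      by (simp add: R\<^sub>3_def)
    moreover have "regular_mod R' z a"
      unfolding a_def using R'(1) reg by (rule regular_mod_mult)
    ultimately have "f v \<in> laurent_over R v"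
      using 1 localization_Int_subset[OF R'(1) zR'] by (auto simp: R'_def)
    moreover have "f \<in> positive_fracs R"
      unfolding f_def
      by (rule seed_run_positive_fracs[OF R(1), of _ w r])
         (use N N' w w' x xR less.prems(6,8) in \<open>auto simp: N'_def\<close>)
    ultimately obtain g where g: "g \<in> polys_over R" "\<And>y. y > 0 \<Longrightarrow> f y = poly g y"
      using positive_fracs_laurent_over[OF R(1) v(2,1)] by blast
    \<comment> \<open>Setting the auxiliary frozen variable to 1 makes its row invisible and
      recovers the original run.\<close>
    have "f 1 \<in> R"
      using g R(1) by (simp add: poly_polys_over is_subring_one)
    moreover have "seed_restricts r N' N (seed_run N' ks (b', x(w := 1))) (seed_run N ks (b, x))"
      using N N' w b' less.prems(6)
      by (intro seed_restricts_run) (auto simp: seed_restricts_def N'_def)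
    ultimately show ?thesis
      using less.prems(8) by (simp add: f_def seed_restricts_def)
  qed
qed

lemma seed_run_mem:
  fixes x :: "nat \<Rightarrow> real"
  assumes N: "finite N" "{1..r} \<subseteq> N" and skew: "skew_symmetrizable r b" and ks: "set ks \<subseteq> {1..r}"
    and S: "finite S" "S \<subseteq> N - {1..r}"
    and R: "is_subring R" "countable R" and x: "\<And>i. i \<in> N \<Longrightarrow> x i > 0 \<and> x i \<in> R"
    and unit: "\<And>i. i \<in> N - S \<Longrightarrow> unit_in R (x i)" and i: "i \<in> N"
  shows "snd (seed_run N ks (b, x)) i \<in> R"
  using S R x unit
proof (induction S arbitrary: R x rule: finite_induct)
  case empty
  then show ?case
    using N skew ks i by (intro seed_run_mem_of_units) auto
next
  case (insert w S)
  note R = insert.prems(2,3) and x = insert.prems(4) and unit = insert.prems(5)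
  have w: "w \<in> N" "w \<notin> {1..r}"
    using insert.prems(1) by auto
  show ?case
  proof (cases "i = w")
    case True
    then show ?thesis
      using w ks x by (subst snd_seed_run_frozen) auto
  next
    case False
    define f where "f = (\<lambda>y. snd (seed_run N ks (b, x(w := y))) i)"
    obtain v where v: "v > 0" "transcendental_over R v"
      using exists_transcendental_over[OF R(2)] by blast
    have "f v \<in> laurent_over R v"
      unfolding f_def
    proof (rule insert.IH)
      show "is_subring (laurent_over R v)" "countable (laurent_over R v)"
        using R v by (auto intro: is_subring_laurent_over countable_laurent_over)
      have v': "unit_in (laurent_over R v) v"
        using R(1) v(1) by (simp add: unit_in_laurent_over)
      note sub = subset_laurent_over[OF R(1), of v]
      show "(x(w := v)) l > 0 \<and> (x(w := v)) l \<in> laurent_over R v" if "l \<in> N" for l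
        using that x v v' sub by (auto simp: unit_in_def)
      show "unit_in (laurent_over R v) ((x(w := v)) l)" if "l \<in> N - S" for l
        using that unit v' unit_in_mono[OF _ sub] by auto
    qed (use insert.prems(1) in auto)
    moreover have "f \<in> positive_fracs R"
      unfolding f_def
      by (rule seed_run_positive_fracs[OF R(1), of _ w r]) (use N w x ks i False in auto)
    ultimately obtain g where g: "g \<in> polys_over R" "\<And>y. y > 0 \<Longrightarrow> f y = poly g y"
      using positive_fracs_laurent_over[OF R(1) v(2,1)] by blast
    have "f (x w) \<in> R"
      using g R(1) x[OF w(1)] by (simp add: poly_polys_over)
    then show ?thesis
      by (simp add: f_def)
  qed
qed

lemma is_subring_Ints: "is_subring (\<int> :: real set)"
  by (simp add: is_subring_def)

text \<open>The unitary choice enters here: the cluster values 1 are units of the integers, and all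
  frozen indices go into \<open>S\<close>.\<close>

lemma seed_run_Ints:
  fixes x :: "nat \<Rightarrow> real"
  assumes "finite N" "{1..r} \<subseteq> N" "skew_symmetrizable r b" "set ks \<subseteq> {1..r}"
    and x: "\<And>i. i \<in> {1..r} \<Longrightarrow> x i = 1" "\<And>i. i \<in> N - {1..r} \<Longrightarrow> x i > 0 \<and> x i \<in> \<int>"
    and "i \<in> N"
  shows "snd (seed_run N ks (b, x)) i \<in> \<int>"
proof (rule seed_run_mem[of N r b ks "N - {1..r}"])
  show "countable (\<int> :: real set)"
    by (auto simp: Ints_def)
  show "x i > 0 \<and> x i \<in> \<int>" if "i \<in> N" for i
    using that x by (cases "i \<in> {1..r}") auto
  show "unit_in \<int> (x i)" if "i \<in> N - (N - {1..r})" for i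
    using that x by (auto simp: unit_in_def)
qed (use assms is_subring_Ints in auto)


section \<open>Specialization of rational functions\<close>

abbreviation qmonomial_eval :: "(nat \<Rightarrow> 'f::field_char_0) \<Rightarrow> (nat \<Rightarrow>\<^sub>0 nat) \<Rightarrow> 'f" where
  "qmonomial_eval x e \<equiv> \<Prod>i\<in>Poly_Mapping.keys e. x i ^ Poly_Mapping.lookup e i"

lemma qmonomial_eval_superset:
  assumes "finite I" "Poly_Mapping.keys e \<subseteq> I"
  shows "qmonomial_eval x e = (\<Prod>i\<in>I. x i ^ Poly_Mapping.lookup e i)"
  using assms by (intro prod.mono_neutral_left) (auto simp: in_keys_iff)

lemma qmonomial_eval_add: "qmonomial_eval x (d + e) = qmonomial_eval x d * qmonomial_eval x e"
proof -
  let ?I = "Poly_Mapping.keys d \<union> Poly_Mapping.keys e"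
  have I: "finite ?I"
    by simp
  show ?thesis
    using qmonomial_eval_superset[OF I keys_add, of x] qmonomial_eval_superset[OF I, of d x]
      qmonomial_eval_superset[OF I, of e x]
    by (simp add: lookup_add power_add prod.distrib)
qed

lemma qpoly_eval_zero: "qpoly_eval x 0 = 0"
  by (simp add: qpoly_eval_def)

lemma qpoly_eval_single: "qpoly_eval x (Poly_Mapping.single e c) = of_rat c * qmonomial_eval x e"
  by (simp add: qpoly_eval_def)

lemma qpoly_eval_add: "qpoly_eval x (p + q) = qpoly_eval x p + qpoly_eval x q"
  unfolding qpoly_eval_def
  by (rule setsum_keys_plus_distrib) (simp_all add: of_rat_add distrib_right)

lemma qpoly_eval_diff: "qpoly_eval x (p - q) = qpoly_eval x p - qpoly_eval x q"
  using qpoly_eval_add[of x "p - q" q] by simp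

lemma qpoly_eval_sum: "qpoly_eval x (\<Sum>i\<in>I. f i) = (\<Sum>i\<in>I. qpoly_eval x (f i))"
  by (induction I rule: infinite_finite_induct) (simp_all add: qpoly_eval_zero qpoly_eval_add)

lemma poly_mapping_sum_single:
  "(\<Sum>k\<in>Poly_Mapping.keys p. Poly_Mapping.single k (Poly_Mapping.lookup p k)) = p"
proof (rule poly_mapping_eqI)
  fix k
  have "Poly_Mapping.lookup (\<Sum>k\<in>Poly_Mapping.keys p. Poly_Mapping.single k (Poly_Mapping.lookup p k)) k =
      (\<Sum>l\<in>Poly_Mapping.keys p. if l = k then Poly_Mapping.lookup p k else 0)"
    unfolding lookup_sum by (intro sum.cong) (auto simp: lookup_single)
  also have "\<dots> = Poly_Mapping.lookup p k"
    by (simp add: in_keys_iff)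
  finally show "Poly_Mapping.lookup (\<Sum>k\<in>Poly_Mapping.keys p. Poly_Mapping.single k (Poly_Mapping.lookup p k)) k =
    Poly_Mapping.lookup p k" .
qed

lemma qpoly_eval_mult: "qpoly_eval x (p * q) = qpoly_eval x p * qpoly_eval x q"
proof -
  have "qpoly_eval x (p * q) =
      qpoly_eval x ((\<Sum>d\<in>Poly_Mapping.keys p. Poly_Mapping.single d (Poly_Mapping.lookup p d)) *
        (\<Sum>e\<in>Poly_Mapping.keys q. Poly_Mapping.single e (Poly_Mapping.lookup q e)))"
    by (simp only: poly_mapping_sum_single)
  also have "\<dots> = (\<Sum>d\<in>Poly_Mapping.keys p. \<Sum>e\<in>Poly_Mapping.keys q.
      of_rat (Poly_Mapping.lookup p d) * of_rat (Poly_Mapping.lookup q e) *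
      (qmonomial_eval x d * qmonomial_eval x e))"
    by (simp only: sum_product qpoly_eval_sum mult_single qpoly_eval_single of_rat_mult qmonomial_eval_add)
  also have "\<dots> = qpoly_eval x p * qpoly_eval x q"
    by (simp add: qpoly_eval_def sum_product mult_ac)
  finally show ?thesis .
qed

lemma qpoly_vars_add: "qpoly_vars (p + q) \<subseteq> qpoly_vars p \<union> qpoly_vars q"
  using keys_add[of p q] unfolding qpoly_vars_def by blast

lemma qpoly_vars_diff: "qpoly_vars (p - q) \<subseteq> qpoly_vars p \<union> qpoly_vars q"
  using keys_diff[of p q] unfolding qpoly_vars_def by blast

lemma qpoly_vars_mult: "qpoly_vars (p * q) \<subseteq> qpoly_vars p \<union> qpoly_vars q"
proof
  fix i assume "i \<in> qpoly_vars (p * q)"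
  then obtain d e where "d \<in> Poly_Mapping.keys p" "e \<in> Poly_Mapping.keys q"
    "i \<in> Poly_Mapping.keys (d + e)"
    using keys_mult[of p q] unfolding qpoly_vars_def by blast
  then show "i \<in> qpoly_vars p \<union> qpoly_vars q"
    using keys_add[of d e] unfolding qpoly_vars_def by blast
qed

definition qpoly_var :: "nat \<Rightarrow> qpoly" where
  "qpoly_var i = Poly_Mapping.single (Poly_Mapping.single i 1) 1"

lemma qpoly_var_simps [simp]:
  "qpoly_vars (qpoly_var i) = {i}"
  "qpoly_eval x (qpoly_var i) = x i"
  by (simp_all add: qpoly_var_def qpoly_vars_def qpoly_eval_single)

lemma qpoly_one_simps [simp]:
  "qpoly_vars 1 = {}"
  "qpoly_eval x 1 = 1"
  by (simp_all add: qpoly_vars_def qpoly_eval_def)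

text \<open>\<open>specializes n x y f c\<close>: \<open>f\<close> is a rational function of \<open>x\<^sub>1, \<dots>, x\<^sub>n\<close> that is regular at the
  point \<open>y\<close> and has the value \<open>c\<close> there.\<close>

definition specializes ::
    "nat \<Rightarrow> (nat \<Rightarrow> 'f::field_char_0) \<Rightarrow> (nat \<Rightarrow> 'g::field_char_0) \<Rightarrow> 'f \<Rightarrow> 'g \<Rightarrow> bool" where
  "specializes n x y f c \<longleftrightarrow>
     (\<exists>p q. qpoly_vars p \<subseteq> {1..n} \<and> qpoly_vars q \<subseteq> {1..n} \<and>
        qpoly_eval x q \<noteq> 0 \<and> qpoly_eval y q \<noteq> 0 \<and>
        f = qpoly_eval x p / qpoly_eval x q \<and> c = qpoly_eval y p / qpoly_eval y q)"

lemma specializesI: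
  assumes "qpoly_vars p \<subseteq> {1..n}" "qpoly_vars q \<subseteq> {1..n}" "qpoly_eval x q \<noteq> 0" "qpoly_eval y q \<noteq> 0"
    "f = qpoly_eval x p / qpoly_eval x q" "c = qpoly_eval y p / qpoly_eval y q"
  shows "specializes n x y f c"
  using assms unfolding specializes_def by blast

lemma specializesE:
  assumes "specializes n x y f c"
  obtains p q where "qpoly_vars p \<subseteq> {1..n}" "qpoly_vars q \<subseteq> {1..n}"
    "qpoly_eval x q \<noteq> 0" "qpoly_eval y q \<noteq> 0"
    "f = qpoly_eval x p / qpoly_eval x q" "c = qpoly_eval y p / qpoly_eval y q"
  using assms unfolding specializes_def by blast

text \<open>Two fractions for \<open>f\<close> give \<open>p * q' - p' * q\<close> the value 0 at
  \<open>x\<close>; independence makes it the zero polynomial, which can be evaluated at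
  \<open>y\<close>.\<close>

lemma specializes_unique:
  assumes x: "algebraically_independent n x"
    and f: "specializes n x y f c" and f': "specializes n x y f c'"
  shows "c = c'"
proof -
  obtain p q where pq: "qpoly_vars p \<subseteq> {1..n}" "qpoly_vars q \<subseteq> {1..n}"
    "qpoly_eval x q \<noteq> 0" "qpoly_eval y q \<noteq> 0"
    "f = qpoly_eval x p / qpoly_eval x q" "c = qpoly_eval y p / qpoly_eval y q"
    using f by (rule specializesE)
  obtain p' q' where pq': "qpoly_vars p' \<subseteq> {1..n}" "qpoly_vars q' \<subseteq> {1..n}"
    "qpoly_eval x q' \<noteq> 0" "qpoly_eval y q' \<noteq> 0"
    "f = qpoly_eval x p' / qpoly_eval x q'" "c' = qpoly_eval y p' / qpoly_eval y q'"
    using f' by (rule specializesE)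
  have "qpoly_vars (p * q' - p' * q) \<subseteq> {1..n}"
    using pq(1,2) pq'(1,2) qpoly_vars_diff qpoly_vars_mult by blast
  moreover have "qpoly_eval x (p * q' - p' * q) = 0"
    using pq(3,5) pq'(3,5) by (simp add: qpoly_eval_diff qpoly_eval_mult field_simps)
  ultimately have "p * q' - p' * q = 0"
    using x unfolding algebraically_independent_def by blast
  then have "qpoly_eval y (p * q' - p' * q) = 0"
    by (simp add: qpoly_eval_zero)
  then show ?thesis
    using pq(4,6) pq'(4,6) by (simp add: qpoly_eval_diff qpoly_eval_mult frac_eq_eq)
qed

section \<open>Compatibility of specialization with field operations and mutation\<close>

lemma specializes_var: "i \<in> {1..n} \<Longrightarrow> specializes n x y (x i) (y i)"
  by (rule specializesI[of "qpoly_var i" _ 1]) auto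

lemma specializes_one: "specializes n x y 1 1"
  by (rule specializesI[of 1 _ 1]) auto

lemma specializes_ops:
  assumes f: "specializes n x y f c" and g: "specializes n x y g d"
  shows specializes_add: "specializes n x y (f + g) (c + d)"
    and specializes_diff: "specializes n x y (f - g) (c - d)"
    and specializes_mult: "specializes n x y (f * g) (c * d)"
    and specializes_divide: "g \<noteq> 0 \<Longrightarrow> d \<noteq> 0 \<Longrightarrow> specializes n x y (f / g) (c / d)"
proof -
  obtain p q where pq: "qpoly_vars p \<subseteq> {1..n}" "qpoly_vars q \<subseteq> {1..n}"
    "qpoly_eval x q \<noteq> 0" "qpoly_eval y q \<noteq> 0"
    "f = qpoly_eval x p / qpoly_eval x q" "c = qpoly_eval y p / qpoly_eval y q"
    using f by (rule specializesE)
  obtain p' q' where pq': "qpoly_vars p' \<subseteq> {1..n}" "qpoly_vars q' \<subseteq> {1..n}"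
    "qpoly_eval x q' \<noteq> 0" "qpoly_eval y q' \<noteq> 0"
    "g = qpoly_eval x p' / qpoly_eval x q'" "d = qpoly_eval y p' / qpoly_eval y q'"
    using g by (rule specializesE)
  have vars: "qpoly_vars (a * b) \<subseteq> I" "qpoly_vars (a + b) \<subseteq> I" "qpoly_vars (a - b) \<subseteq> I"
    if "qpoly_vars a \<subseteq> I" "qpoly_vars b \<subseteq> I" for a b I
    using that qpoly_vars_mult qpoly_vars_add qpoly_vars_diff by blast+
  note simps = vars qpoly_eval_add qpoly_eval_diff qpoly_eval_mult add_frac_eq diff_frac_eq
  show "specializes n x y (f + g) (c + d)"
    by (rule specializesI[of "p * q' + p' * q" _ "q * q'"])
       (use pq pq' in \<open>simp_all add: simps\<close>)
  show "specializes n x y (f - g) (c - d)"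
    by (rule specializesI[of "p * q' - p' * q" _ "q * q'"])
       (use pq pq' in \<open>simp_all add: simps\<close>)
  show "specializes n x y (f * g) (c * d)"
    by (rule specializesI[of "p * p'" _ "q * q'"])
       (use pq pq' in \<open>simp_all add: simps\<close>)
  show "specializes n x y (f / g) (c / d)" if "g \<noteq> 0" "d \<noteq> 0"
    by (rule specializesI[of "p * q'" _ "q * p'"])
       (use pq pq' that in \<open>simp_all add: simps\<close>)
qed

lemma specializes_prod_power:
  assumes "\<And>i. i \<in> I \<Longrightarrow> specializes n x y (f i) (c i)"
  shows "specializes n x y (\<Prod>i\<in>I. f i ^ e i) (\<Prod>i\<in>I. c i ^ e i)"
proof -
  have pow: "specializes n x y (f i ^ k) (c i ^ k)" if "i \<in> I" for i k
    using assms[OF that] by (induction k) (simp_all add: specializes_one specializes_mult)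
  show ?thesis
    using pow by (induction I rule: infinite_finite_induct) (simp_all add: specializes_one specializes_mult)
qed

lemma specializes_nonzero:
  assumes x: "algebraically_independent n x" and f: "specializes n x y f c" and c: "c \<noteq> 0"
  shows "f \<noteq> 0"
proof
  assume "f = 0"
  moreover have "specializes n x y 0 0"
    using specializes_diff[OF specializes_one specializes_one, of n x y] by simp
  ultimately show False
    using specializes_unique[OF x f] c by blast
qed

text \<open>All values at the positive point \<open>y\<close> stay positive, so no denominator
  vanishes there; by \<open>specializes_nonzero\<close> the one over \<open>x\<close> does not
  vanish either.\<close>

lemma specializes_seed_run:
  fixes y :: "nat \<Rightarrow> real"
  assumes x: "algebraically_independent n x" and y: "\<And>i. i \<in> {1..n} \<Longrightarrow> y i > 0"
    and ks: "set ks \<subseteq> {1..n}" and i: "i \<in> {1..n}"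
  shows "specializes n x y (snd (seed_run {1..n} ks (b, x)) i) (snd (seed_run {1..n} ks (b, y)) i)"
  using ks i
proof (induction ks arbitrary: i rule: rev_induct)
  case Nil
  then show ?case
    by (simp add: specializes_var)
next
  case (snoc k ks)
  define s where "s = seed_run {1..n} ks (b, x)"
  define s' where "s' = seed_run {1..n} ks (b, y)"
  have IH: "specializes n x y (snd s i) (snd s' i)" if "i \<in> {1..n}" for i
    unfolding s_def s'_def using snoc.prems(1) that by (intro snoc.IH) auto
  have k: "k \<in> {1..n}"
    using snoc.prems by simp
  have "snd s' k > 0"
    unfolding s'_def using y snoc.prems(1) k by (intro seed_run_pos) auto
  moreover have fst: "fst s' = fst s"
    by (simp add: s_def s'_def fst_seed_run)
  moreover have "specializes n x y (exchange_sum {1..n} k (fst s) (snd s)) (exchange_sum {1..n} k (fst s) (snd s'))"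
    unfolding exchange_sum_def by (intro specializes_add specializes_prod_power IH)
  ultimately have "specializes n x y (snd (seed_step {1..n} k s) i) (snd (seed_step {1..n} k s') i)"
    using IH[OF k] IH[OF snoc.prems(2)] specializes_nonzero[OF x IH[OF k]]
    by (simp add: seed_step_def specializes_divide)
  then show ?case
    by (simp add: s_def s'_def)
qed


section \<open>Seed patterns\<close>

text \<open>Induction along a simple path from \<open>t\<^sub>0\<close> to \<open>t\<close>; the
  labelling bijection at each vertex bounds the label of the next edge.\<close>

lemma tree_induct [consumes 3, case_names base step]:
  assumes tree: "labelled_regular_tree r V E lab" and t: "t\<^sub>0 \<in> V" "t \<in> V" and base: "P t\<^sub>0"
    and step: "\<And>t t'. t \<in> V \<Longrightarrow> t' \<in> V \<Longrightarrow> {t, t'} \<in> E \<Longrightarrow> lab {t, t'} \<in> {1..r} \<Longrightarrow> P t \<Longrightarrow> P t'"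
  shows "P t"
proof -
  obtain vs where vs: "simple_path V E t\<^sub>0 t vs"
    using tree t unfolding labelled_regular_tree_def is_tree_def by metis
  have "i < length vs \<longrightarrow> P (vs ! i)" for i
  proof (induction i)
    case 0
    show ?case
      using vs base by (auto simp: simple_path_def hd_conv_nth)
  next
    case (Suc i)
    show ?case
    proof
      assume i: "Suc i < length vs"
      have in_V: "vs ! i \<in> V" "vs ! Suc i \<in> V"
        using vs i by (auto simp: simple_path_def intro!: subsetD[of "set vs" V])
      moreover have edge: "{vs ! i, vs ! Suc i} \<in> E"
        using vs i by (simp add: simple_path_def)
      moreover have "bij_betw lab {e \<in> E. vs ! i \<in> e} {1..r}"
        using tree in_V by (simp add: labelled_regular_tree_def)
      then have "lab {vs ! i, vs ! Suc i} \<in> {1..r}"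
        using edge by (auto dest!: bij_betw_apply[of _ _ _ "{vs ! i, vs ! Suc i}"])
      ultimately show "P (vs ! Suc i)"
        using step Suc i by simp
    qed
  qed
  moreover have "vs \<noteq> []" "t = vs ! (length vs - 1)"
    using vs by (auto simp: simple_path_def last_conv_nth)
  ultimately show ?thesis
    by simp
qed

text \<open>Merges cluster and frozen entries into one family indexed like the rows of
  \<open>exch\<close>, with frozen entries shifted by \<open>r\<close>.\<close>

definition seed_values :: "nat \<Rightarrow> 'f seed \<Rightarrow> (nat \<Rightarrow> nat \<Rightarrow> int) \<times> (nat \<Rightarrow> 'f)" where
  "seed_values r S = (exch S, extended_cluster r S)"

lemma monomial_pos_part: "monomial n a (\<lambda>i. pos_part (e i)) = (\<Prod>i\<in>{1..n}. a i ^ nat (e i))"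
  unfolding monomial_def by (intro prod.cong) (simp_all add: pos_part_def power_int_def max_def)

lemma exchange_sum_extended_cluster:
  "exchange_sum {1..r + l} k (exch S) (extended_cluster r S) =
     monomial r (cluster S) (\<lambda>i. pos_part (exch S i k)) *
       monomial l (frozen S) (\<lambda>i. pos_part (exch S (r + i) k)) +
     monomial r (cluster S) (\<lambda>i. pos_part (- exch S i k)) *
       monomial l (frozen S) (\<lambda>i. pos_part (- exch S (r + i) k))"
proof -
  have "(\<Prod>i\<in>{1..r + l}. extended_cluster r S i ^ e i) =
      (\<Prod>i\<in>{1..r}. cluster S i ^ e i) * (\<Prod>i\<in>{1..l}. frozen S i ^ e (r + i))" for e
  proof -
    have "1 \<le> r + 1"
      by simp
    from prod.ub_add_nat[OF this, of "\<lambda>i. extended_cluster r S i ^ e i" l]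
    have "(\<Prod>i\<in>{1..r + l}. extended_cluster r S i ^ e i) =
        (\<Prod>i\<in>{1..r}. extended_cluster r S i ^ e i) * (\<Prod>i\<in>{1 + r..l + r}. extended_cluster r S i ^ e i)"
      by (simp only: add.commute[of r])
    also have "(\<Prod>i\<in>{1 + r..l + r}. extended_cluster r S i ^ e i) =
        (\<Prod>i\<in>{1..l}. extended_cluster r S (i + r) ^ e (i + r))"
      by (rule prod.shift_bounds_cl_nat_ivl)
    also have "\<dots> = (\<Prod>i\<in>{1..l}. frozen S i ^ e (r + i))"
      by (intro prod.cong) (auto simp: extended_cluster_def add.commute)
    also have "(\<Prod>i\<in>{1..r}. extended_cluster r S i ^ e i) = (\<Prod>i\<in>{1..r}. cluster S i ^ e i)"
      by (intro prod.cong) (auto simp: extended_cluster_def)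
    finally show ?thesis .
  qed
  then show ?thesis
    unfolding exchange_sum_def monomial_pos_part by simp
qed

lemma seed_values_mutate:
  assumes "k \<in> {1..r}"
  shows "seed_values r (mutate r l k S) = seed_step {1..r + l} k (seed_values r S)"
  unfolding seed_values_def seed_step_def fst_conv snd_conv exchange_sum_extended_cluster
  using assms by (auto simp: mutate_def extended_cluster_def fun_eq_iff mutate_cluster_def)

lemma seed_eq_imp_seed_restricts:
  assumes "seed_eq r l S S'"
  shows "seed_restricts r {1..r + l} {1..r + l} (seed_values r S) (seed_values r S')"
proof -
  have "frozen S (i - r) = frozen S' (i - r)" if "i \<le> r + l" "\<not> i \<le> r" for i
  proof -
    have "i - r \<in> {1..l}"
      using that by auto
    then show ?thesis
      using assms unfolding seed_eq_def by blast
  qed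
  then show ?thesis
    using assms by (auto simp: seed_eq_def seed_restricts_def seed_values_def extended_cluster_def)
qed

lemma seed_pattern_edge:
  assumes "seed_pattern F r l V E lab \<S>" "t \<in> V" "t' \<in> V" "{t, t'} \<in> E" "lab {t, t'} \<in> {1..r}"
  shows "seed_restricts r {1..r + l} {1..r + l}
    (seed_values r (\<S> t')) (seed_step {1..r + l} (lab {t, t'}) (seed_values r (\<S> t)))"
  using assms seed_eq_imp_seed_restricts[of r l "\<S> t'" "mutate r l (lab {t, t'}) (\<S> t)"]
  by (simp add: seed_pattern_def seed_values_mutate)

text \<open>Seeds in a pattern are tied together only on meaningful indices, so the comparison uses
  \<open>seed_restricts\<close> rather than equality.\<close>

lemma seed_pattern_run:
  assumes tree: "labelled_regular_tree r V E lab" and pat: "seed_pattern F r l V E lab \<S>"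
    and t: "t\<^sub>0 \<in> V" "t \<in> V"
  shows "\<exists>ks. set ks \<subseteq> {1..r} \<and> seed_restricts r {1..r + l} {1..r + l}
    (seed_values r (\<S> t)) (seed_run {1..r + l} ks (seed_values r (\<S> t\<^sub>0)))"
  using tree t
proof (induction rule: tree_induct)
  case base
  show ?case
    by (rule exI[of _ "[]"]) (simp add: seed_restricts_def)
next
  case (step t t')
  let ?N = "{1..r + l}"
  obtain ks where ks: "set ks \<subseteq> {1..r}"
    and IH: "seed_restricts r ?N ?N (seed_values r (\<S> t)) (seed_run ?N ks (seed_values r (\<S> t\<^sub>0)))"
    using step by blast
  have "seed_restricts r ?N ?N (seed_step ?N (lab {t, t'}) (seed_values r (\<S> t)))
      (seed_step ?N (lab {t, t'}) (seed_run ?N ks (seed_values r (\<S> t\<^sub>0))))"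
    using step(4) IH by (intro seed_restricts_step) auto
  then have "seed_restricts r ?N ?N (seed_values r (\<S> t'))
      (seed_run ?N (ks @ [lab {t, t'}]) (seed_values r (\<S> t\<^sub>0)))"
    using seed_pattern_edge[OF pat step(1-4)] by (simp add: seed_restricts_def)
  then show ?case
    using ks step(4) by (intro exI[of _ "ks @ [lab {t, t'}]"]) auto
qed

section \<open>Extended cluster variables as generators\<close>

lemma extended_cluster_variables_eq:
  "extended_cluster_variables r l V \<S> = (\<Union>t\<in>V. extended_cluster r (\<S> t) ` {1..r + l})"
proof -
  have "cluster S ` {1..r} \<union> frozen S ` {1..l} = extended_cluster r S ` {1..r + l}" for S :: "'a seed"
  proof -
    have "{1..r + l} = {1..r} \<union> (+) r ` {1..l}"
      by (auto simp: image_iff Bex_def intro: exI[of _ "_ - r"])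
    moreover have "extended_cluster r S ` {1..r} = cluster S ` {1..r}"
      by (intro image_cong) (auto simp: extended_cluster_def)
    moreover have "extended_cluster r S ` (+) r ` {1..l} = frozen S ` {1..l}"
      unfolding image_image by (intro image_cong) (auto simp: extended_cluster_def)
    ultimately show ?thesis
      by (simp add: image_Un)
  qed
  then show ?thesis
    unfolding extended_cluster_variables_def by simp
qed

lemma extended_cluster_mem_cluster_algebra:
  assumes "t \<in> V" "i \<in> {1..r + l}"
  shows "extended_cluster r (\<S> t) i \<in> cluster_algebra r l V \<S>"
proof -
  have "extended_cluster r (\<S> t) i \<in> extended_cluster_variables r l V \<S>"
    unfolding extended_cluster_variables_eq using assms by blast
  then show ?thesis
    unfolding cluster_algebra_def by (rule hull_inc)
qed

lemma extended_cluster_nonzero: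
  assumes "is_seed F r l S" "i \<in> {1..r + l}"
  shows "extended_cluster r S i \<noteq> 0"
proof
  assume "extended_cluster r S i = 0"
  moreover have "algebraically_independent (r + l) (extended_cluster r S)"
    using assms by (simp add: is_seed_def freely_generates_def)
  ultimately have "qpoly_var i = 0"
    using assms(2) unfolding algebraically_independent_def by (metis qpoly_var_simps empty_subsetI insert_subset)
  then show False
    by (metis qpoly_var_simps(1) empty_not_insert qpoly_vars_def keys_zero UN_empty)
qed


section \<open>Existence and uniqueness of unitary friezes\<close>

lemma ring_hom_on_prod_power:
  assumes A: "is_subring A" and h: "ring_hom_on A h" and f: "\<And>i. i \<in> I \<Longrightarrow> f i \<in> A"
  shows "h (\<Prod>i\<in>I. f i ^ e i) = (\<Prod>i\<in>I. h (f i) ^ e i)"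
proof -
  have pow: "h (a ^ k) = h a ^ k" if "a \<in> A" for a k
    using that A h by (induction k) (simp_all add: ring_hom_on_def is_subring_power)
  have "h (\<Prod>i\<in>I. f i ^ e i) = (\<Prod>i\<in>I. h (f i) ^ e i)" if "finite I"
    using that f
  proof (induction I rule: finite_induct)
    case empty
    then show ?case
      using h by (simp add: ring_hom_on_def)
  next
    case (insert j I)
    have "f j ^ e j \<in> A" "(\<Prod>i\<in>I. f i ^ e i) \<in> A"
      using A insert by (auto intro: is_subring_power is_subring_prod)
    then show ?case
      using h insert pow by (simp add: ring_hom_on_def)
  qed
  moreover have "h 1 = 1"
    using h by (simp add: ring_hom_on_def)
  ultimately show ?thesis
    by (cases "finite I") auto
qed

text \<open>A frieze restricted to a seed determines the frieze on the adjacent seeds, because the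
  exchange relation is linear in the new variable with a coefficient of positive value.\<close>

lemma friezes_eq_on_cluster_variables:
  assumes tree: "labelled_regular_tree r V E lab" and pat: "seed_pattern F r l V E lab \<S>"
    and t: "t\<^sub>0 \<in> V" "t \<in> V"
    and h: "frieze r l V \<S> h" and h': "frieze r l V \<S> h'"
    and eq: "\<And>i. i \<in> {1..r + l} \<Longrightarrow> h (extended_cluster r (\<S> t\<^sub>0) i) = h' (extended_cluster r (\<S> t\<^sub>0) i)"
    and i: "i \<in> {1..r + l}"
  shows "h (extended_cluster r (\<S> t) i) = h' (extended_cluster r (\<S> t) i)"
proof -
  let ?N = "{1..r + l}" and ?A = "cluster_algebra r l V \<S>"
  have A: "is_subring ?A"
    unfolding cluster_algebra_def by (rule is_subring_hull)
  have "\<forall>i\<in>?N. h (extended_cluster r (\<S> t) i) = h' (extended_cluster r (\<S> t) i)"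
    using tree t
  proof (induction rule: tree_induct)
    case base
    show ?case
      using eq by blast
  next
    case (step t t')
    define k where "k = lab {t, t'}"
    define x where "x = extended_cluster r (\<S> t)"
    define x' where "x' = extended_cluster r (\<S> t')"
    have k: "k \<in> {1..r}" "k \<in> ?N"
      using step(4) by (auto simp: k_def)
    have mem: "x i \<in> ?A" "x' i \<in> ?A" if "i \<in> ?N" for i
      unfolding x_def x'_def using that step(1,2) by (auto intro: extended_cluster_mem_cluster_algebra)
    have IH: "h (x i) = h' (x i)" if "i \<in> ?N" for i
      using step(5) that unfolding x_def by blast
    have x': "x' i = snd (seed_step ?N k (exch (\<S> t), x)) i" if "i \<in> ?N" for i
      using seed_pattern_edge[OF pat step(1-4)] that
      by (auto simp: seed_restricts_def seed_values_def x_def x'_def k_def)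
    have "is_seed F r l (\<S> t)"
      using pat step(1) by (simp add: seed_pattern_def)
    then have "x k \<noteq> 0"
      unfolding x_def using k(2) by (rule extended_cluster_nonzero)
    then have exchange: "x' k * x k = exchange_sum ?N k (exch (\<S> t)) x"
      using x'[OF k(2)] by (simp add: seed_step_def)
    have hk: "g (x' k) * g (x k) = (\<Prod>i\<in>?N. g (x i) ^ nat (exch (\<S> t) i k)) +
        (\<Prod>i\<in>?N. g (x i) ^ nat (- exch (\<S> t) i k))" if g: "frieze r l V \<S> g" for g
    proof -
      have hom: "ring_hom_on ?A g"
        using g by (simp add: frieze_def)
      have "g (x' k) * g (x k) = g (x' k * x k)"
        using hom mem k(2) by (simp add: ring_hom_on_def)
      also have "\<dots> = g (\<Prod>i\<in>?N. x i ^ nat (exch (\<S> t) i k)) + g (\<Prod>i\<in>?N. x i ^ nat (- exch (\<S> t) i k))"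
      proof -
        have "(\<Prod>i\<in>?N. x i ^ e i) \<in> ?A" for e
          using A mem by (intro is_subring_prod is_subring_power)
        moreover have "g (a + b) = g a + g b" if "a \<in> ?A" "b \<in> ?A" for a b
          using hom that unfolding ring_hom_on_def by blast
        ultimately show ?thesis
          by (simp only: exchange exchange_sum_def)
      qed
      also have "\<dots> = (\<Prod>i\<in>?N. g (x i) ^ nat (exch (\<S> t) i k)) +
          (\<Prod>i\<in>?N. g (x i) ^ nat (- exch (\<S> t) i k))"
        by (simp only: ring_hom_on_prod_power[OF A hom, of ?N x, OF mem(1)])
      finally show ?thesis .
    qed
    have "x k \<in> extended_cluster_variables r l V \<S>"
      unfolding extended_cluster_variables_eq x_def using step(1) k(2) by blast
    then have "h (x k) > 0"
      using h by (simp add: frieze_def)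
    moreover have "h (x' k) * h (x k) = h' (x' k) * h (x k)"
      using hk[OF h] hk[OF h'] IH IH[OF k(2)] by simp
    ultimately have "h (x' k) = h' (x' k)"
      by simp
    moreover have "x' i = x i" if "i \<in> ?N" "i \<noteq> k" for i
      using x'[OF that(1)] that(2) by (simp add: snd_seed_step_other)
    ultimately show ?case
      using IH unfolding x'_def[symmetric] by metis
  qed
  then show ?thesis
    using i by blast
qed

text \<open>The set where two friezes agree is a subring containing all generators; outside the
  algebra both are \<open>undefined\<close> by extensionality.\<close>

lemma friezes_eq:
  assumes tree: "labelled_regular_tree r V E lab" and pat: "seed_pattern F r l V E lab \<S>"
    and t\<^sub>0: "t\<^sub>0 \<in> V" and h: "frieze r l V \<S> h" and h': "frieze r l V \<S> h'"
    and eq: "\<And>i. i \<in> {1..r + l} \<Longrightarrow> h (extended_cluster r (\<S> t\<^sub>0) i) = h' (extended_cluster r (\<S> t\<^sub>0) i)"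
  shows "h = h'"
proof -
  let ?A = "cluster_algebra r l V \<S>"
  have A: "is_subring ?A"
    unfolding cluster_algebra_def by (rule is_subring_hull)
  have hom: "ring_hom_on ?A h" "ring_hom_on ?A h'"
    using h h' by (auto simp: frieze_def)
  \<comment> \<open>\<open>ring_hom_on\<close> speaks of sums and subrings are closed under
    differences, so compatibility with differences is derived.\<close>
  have diff: "g (a - b) = g a - g b" if "ring_hom_on ?A g" "a \<in> ?A" "b \<in> ?A" for g a b
  proof -
    have "g ((a - b) + b) = g (a - b) + g b"
      using that is_subring_diff[OF A] unfolding ring_hom_on_def by blast
    then show ?thesis
      by simp
  qed
  have "is_subring {a \<in> ?A. h a = h' a}"
    unfolding is_subring_def
    using hom A diff[OF hom(1)] diff[OF hom(2)]
    by (auto simp: ring_hom_on_def is_subring_one is_subring_diff is_subring_mult)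
  moreover have "extended_cluster_variables r l V \<S> \<subseteq> {a \<in> ?A. h a = h' a}"
    unfolding extended_cluster_variables_eq
    using friezes_eq_on_cluster_variables[OF tree pat t\<^sub>0 _ h h' eq]
    by (auto intro: extended_cluster_mem_cluster_algebra)
  ultimately have "?A \<subseteq> {a \<in> ?A. h a = h' a}"
    by (subst cluster_algebra_def) (rule hull_minimal)
  then show ?thesis
    using h h' by (intro extensionalityI[of h ?A h']) (auto simp: frieze_def)
qed

text \<open>The frieze is specialization at the point \<open>m\<close>. Functions with an integer
  value there form a subring, so it suffices to treat the generators.\<close>

lemma frieze_exists:
  fixes m :: "nat \<Rightarrow> int"
  assumes tree: "labelled_regular_tree r V E lab" and pat: "seed_pattern F r l V E lab \<S>"
    and t\<^sub>0: "t\<^sub>0 \<in> V" and y: "\<And>i. i \<in> {1..r} \<Longrightarrow> m i = 1" "\<And>i. i \<in> {1..r + l} \<Longrightarrow> m i > 0"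
  shows "\<exists>h. frieze r l V \<S> h \<and> (\<forall>i\<in>{1..r + l}. h (extended_cluster r (\<S> t\<^sub>0) i) = m i)"
proof -
  let ?N = "{1..r + l}" and ?A = "cluster_algebra r l V \<S>"
  define x where "x = extended_cluster r (\<S> t\<^sub>0)"
  define y where "y i = real_of_int (m i)" for i
  \<comment> \<open>Integers are compared through their images in the reals, where the positivity
    and integrality results for mutation hold.\<close>
  define sp where "sp f k \<longleftrightarrow> specializes (r + l) x y f (real_of_int k)" for f and k :: int
  have "is_seed F r l (\<S> t\<^sub>0)"
    using pat t\<^sub>0 by (simp add: seed_pattern_def)
  then have x: "algebraically_independent (r + l) x" and skew: "skew_symmetrizable r (exch (\<S> t\<^sub>0))"
    by (simp_all add: is_seed_def freely_generates_def x_def)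
  have A: "is_subring ?A"
    unfolding cluster_algebra_def by (rule is_subring_hull)
  have unique: "k = k'" if "sp f k" "sp f k'" for f k k'
    using specializes_unique[OF x] that unfolding sp_def by (metis of_int_eq_iff)
  have var: "\<exists>k>0. sp (extended_cluster r (\<S> t) i) k" if t: "t \<in> V" and i: "i \<in> ?N" for t i
  proof -
    obtain ks where ks: "set ks \<subseteq> {1..r}" and
      "seed_restricts r ?N ?N (seed_values r (\<S> t)) (seed_run ?N ks (seed_values r (\<S> t\<^sub>0)))"
      using seed_pattern_run[OF tree pat t\<^sub>0 t] by blast
    then have "extended_cluster r (\<S> t) i = snd (seed_run ?N ks (exch (\<S> t\<^sub>0), x)) i"
      using i by (auto simp: seed_restricts_def seed_values_def x_def)
    moreover define c where "c = snd (seed_run ?N ks (exch (\<S> t\<^sub>0), y)) i"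
    have "specializes (r + l) x y (snd (seed_run ?N ks (exch (\<S> t\<^sub>0), x)) i) c"
      unfolding c_def using x ks i assms(5) by (intro specializes_seed_run) (auto simp: y_def)
    moreover have "c > 0"
      unfolding c_def using ks i assms(5) by (intro seed_run_pos) (auto simp: y_def)
    \<comment> \<open>The Laurent phenomenon enters at this point.\<close>
    moreover have "c \<in> \<int>"
      unfolding c_def using ks i skew assms(4,5) by (intro seed_run_Ints[of _ r]) (auto simp: y_def)
    ultimately show ?thesis
      unfolding sp_def by (auto elim!: Ints_cases)
  qed
  have "is_subring {f. \<exists>k. sp f k}"
    unfolding is_subring_def
  proof (intro conjI ballI)
    have "sp 1 1"
      by (simp add: sp_def specializes_one)
    then show "1 \<in> {f. \<exists>k. sp f k}"
      by blast
    fix f g assume "f \<in> {f. \<exists>k. sp f k}" "g \<in> {f. \<exists>k. sp f k}"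
    then obtain k k' where "sp f k" "sp g k'"
      by blast
    then have "sp (f - g) (k - k')" "sp (f * g) (k * k')"
      by (simp_all add: sp_def specializes_diff specializes_mult)
    then show "f - g \<in> {f. \<exists>k. sp f k}" "f * g \<in> {f. \<exists>k. sp f k}"
      by blast+
  qed
  moreover have "extended_cluster_variables r l V \<S> \<subseteq> {f. \<exists>k. sp f k}"
    unfolding extended_cluster_variables_eq using var by blast
  ultimately have A_sp: "?A \<subseteq> {f. \<exists>k. sp f k}"
    unfolding cluster_algebra_def by (intro hull_minimal)
  \<comment> \<open>On the algebra, \<open>A_sp\<close> and \<open>unique\<close> make the
    description well defined; \<open>restrict\<close> makes the function extensional.\<close>
  define h where "h = restrict (\<lambda>f. THE k. sp f k) ?A"
  have h: "h f = k" if "f \<in> ?A" "sp f k" for f k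
    using that unique by (auto simp: h_def)
  have h_sp: "sp f (h f)" if "f \<in> ?A" for f
    using that A_sp h by blast
  have "ring_hom_on ?A h"
    unfolding ring_hom_on_def
  proof (intro conjI ballI)
    show "h 1 = 1"
      using is_subring_one[OF A] by (intro h) (simp_all add: sp_def specializes_one)
    fix f g assume fg: "f \<in> ?A" "g \<in> ?A"
    have "sp (f + g) (h f + h g)" "sp (f * g) (h f * h g)"
      using h_sp[OF fg(1)] h_sp[OF fg(2)] by (simp_all add: sp_def specializes_add specializes_mult)
    then show "h (f + g) = h f + h g" "h (f * g) = h f * h g"
      using h fg A by (auto intro: is_subring_add is_subring_mult)
  qed
  moreover have "h f > 0" if f: "f \<in> extended_cluster_variables r l V \<S>" for f
  proof -
    obtain t i where ti: "t \<in> V" "i \<in> ?N" "f = extended_cluster r (\<S> t) i"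
      using f unfolding extended_cluster_variables_eq by blast
    then show ?thesis
      using var[OF ti(1,2)] h extended_cluster_mem_cluster_algebra[OF ti(1,2)] by metis
  qed
  moreover have "h \<in> extensional ?A"
    by (simp add: h_def)
  ultimately have "frieze r l V \<S> h"
    by (simp add: frieze_def)
  moreover have "h (extended_cluster r (\<S> t\<^sub>0) i) = m i" if "i \<in> ?N" for i
    using specializes_var[OF that, of x y] extended_cluster_mem_cluster_algebra[OF t\<^sub>0 that]
    by (intro h) (simp_all add: sp_def x_def y_def)
  ultimately show ?thesis
    by blast
qed

theorem mainTheorem5:
  fixes F :: "'f::field_char_0 set"
    and r l :: nat
    and V :: "'v set" and E :: "'v set set" and lab :: "'v set \<Rightarrow> nat"
    and \<S> :: "'v \<Rightarrow> 'f seed"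
    and t\<^sub>0 :: 'v
    and m :: "nat \<Rightarrow> int"
  assumes "rational_function_field F (r + l)"
    and "labelled_regular_tree r V E lab"
    and "seed_pattern F r l V E lab \<S>"
    and "t\<^sub>0 \<in> V"
    and "\<forall>j\<in>{1..l}. m j > 0"
  shows "\<exists>!h. frieze r l V \<S> h \<and>
           (\<forall>i\<in>{1..r}. h (cluster (\<S> t\<^sub>0) i) = 1) \<and>
           (\<forall>j\<in>{1..l}. h (frozen (\<S> t\<^sub>0) j) = m j)"
proof -
  \<comment> \<open>The prescribed values as one point indexed like the extended cluster, hence the
    shift by \<open>r\<close>.\<close>
  define m' where "m' i = (if i \<le> r then 1 else m (i - r))" for i
  have value_iff: "(\<forall>i\<in>{1..r}. h (cluster (\<S> t\<^sub>0) i) = 1) \<and> (\<forall>j\<in>{1..l}. h (frozen (\<S> t\<^sub>0) j) = m j) \<longleftrightarrow>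
      (\<forall>i\<in>{1..r + l}. h (extended_cluster r (\<S> t\<^sub>0) i) = m' i)" (is "?L \<longleftrightarrow> ?R") for h :: "'f \<Rightarrow> int"
  proof
    assume ?L
    moreover have "i - r \<in> {1..l}" if "i \<in> {1..r + l}" "\<not> i \<le> r" for i
      using that by auto
    ultimately show ?R
      by (simp add: extended_cluster_def m'_def)
  next
    assume R: ?R
    have "h (cluster (\<S> t\<^sub>0) i) = 1" if "i \<in> {1..r}" for i
      using R[rule_format, of i] that by (simp add: extended_cluster_def m'_def)
    moreover have "h (frozen (\<S> t\<^sub>0) j) = m j" if "j \<in> {1..l}" for j
      using R[rule_format, of "r + j"] that by (simp add: extended_cluster_def m'_def)
    ultimately show ?L
      by blast
  qed
  have "\<exists>h. frieze r l V \<S> h \<and> (\<forall>i\<in>{1..r + l}. h (extended_cluster r (\<S> t\<^sub>0) i) = m' i)"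
  proof (rule frieze_exists[OF assms(2-4)])
    show "m' i > 0" if "i \<in> {1..r + l}" for i
    proof (cases "i \<le> r")
      case False
      with that have "i - r \<in> {1..l}"
        by auto
      with False assms(5) show ?thesis
        by (simp add: m'_def)
    qed (simp add: m'_def)
  qed (simp add: m'_def)
  moreover have "h = h'" if "frieze r l V \<S> h" "\<forall>i\<in>{1..r + l}. h (extended_cluster r (\<S> t\<^sub>0) i) = m' i"
    "frieze r l V \<S> h'" "\<forall>i\<in>{1..r + l}. h' (extended_cluster r (\<S> t\<^sub>0) i) = m' i" for h h'
    using that by (intro friezes_eq[OF assms(2-4)]) auto
  ultimately show ?thesis
    unfolding value_iff by blast
qed

end
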